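(* Let $\alpha,\beta$ be irrational real numbers and let $\phi:[1,\infty)\to(0,1/4]$ be a non-increasing function such that $q\cdot\|q\alpha\|\cdot\|q\beta\|\geq\phi(q)$ for all positive integers $q$. Let $Q\geq1$, $\varepsilon>0$, $T>0$ be real numbers with $\varepsilon/T^2\leq 1/e^2$. Define $$M_{\alpha,\beta}(\varepsilon,T,Q)=\{(p_1,p_2,q)\in\mathbb Z^3:\ |p_1+q\alpha|\cdot|p_2+q\beta|<\varepsilon,\ \max\{|p_1+q\alpha|,|p_2+q\beta|\}\leq T,\ 0<q\leq Q\}.$$ Then, with $C_1=3^{28}$, $$\left||M_{\alpha,\beta}(\varepsilon,T,Q)|-4\varepsilon Q\left(\log\left(\frac{T^2}{\varepsilon}\right)+1\right)\right|\leq C_1(1+2T)^2\log\left(\frac{T^2}{\varepsilon}\right)\left(\frac{\varepsilon Q}{\phi(Q)}\right)^{2/3}.$$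
   Context: $\|x\|$ denotes the distance from the real number $x$ to the nearest integer; $e$ is the base of the natural logarithm $\log$. "Non-increasing" means $x\leq y$ implies $\phi(x)\geq\phi(y)$. *)

theory Defs
  imports "HOL-Analysis.Analysis"
begin

definition dist_int :: "real \<Rightarrow> real" where
  "dist_int x = infdist x \<int>"

lemma dist_int_eq_round: "dist_int x = \<bar>x - of_int (round x)\<bar>"
proof (rule antisym)
  show "dist_int x \<le> \<bar>x - of_int (round x)\<bar>"
    unfolding dist_int_def using infdist_le[of "of_int (round x)" \<int> x]
    by (simp add: dist_real_def)
  have "\<bar>x - of_int (round x)\<bar> \<le> dist x a" if "a \<in> \<int>" for a
    using that round_diff_minimal[of x] by (auto simp: dist_real_def elim!: Ints_cases)
  then show "\<bar>x - of_int (round x)\<bar> \<le> dist_int x"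
    unfolding dist_int_def infdist_def by (auto intro!: cINF_greatest)
qed

definition M_set :: "real \<Rightarrow> real \<Rightarrow> real \<Rightarrow> real \<Rightarrow> real \<Rightarrow> (int \<times> int \<times> int) set" where
  "M_set \<alpha> \<beta> \<epsilon> T Q = {(p1, p2, q).
     \<bar>of_int p1 + of_int q * \<alpha>\<bar> * \<bar>of_int p2 + of_int q * \<beta>\<bar> < \<epsilon> \<and>
     max \<bar>of_int p1 + of_int q * \<alpha>\<bar> \<bar>of_int p2 + of_int q * \<beta>\<bar> \<le> T \<and>
     0 < q \<and> of_int q \<le> Q}"

text \<open>Since \<^const>\<open>card\<close> is \<open>0\<close> on infinite sets, finiteness is what makes
  \<open>card (M_set \<alpha> \<beta> \<epsilon> T Q)\<close> the actual number of points.\<close>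

lemma finite_M_set: "finite (M_set \<alpha> \<beta> \<epsilon> T Q)"
proof -
  define B where "B q = (\<lambda>x::real. {p::int. \<bar>of_int p + of_int q * x\<bar> \<le> T})" for q :: int
  have fin: "finite (B q x)" for q x
  proof (rule finite_subset)
    show "B q x \<subseteq> {\<lfloor>- T - of_int q * x\<rfloor>..\<lceil>T - of_int q * x\<rceil>}"
      unfolding B_def by (auto simp: floor_le_iff le_ceiling_iff abs_le_iff)
  qed simp
  have "M_set \<alpha> \<beta> \<epsilon> T Q \<subseteq> (\<Union>q\<in>{0<..\<lfloor>Q\<rfloor>}. B q \<alpha> \<times> B q \<beta> \<times> {q})"
    unfolding M_set_def B_def by (auto simp: le_floor_iff)
  then show ?thesis
    by (rule finite_subset) (auto intro: fin)
qed

end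

theory Submission
  imports Defs
begin

text \<open>
  The points \<open>(p\<^sub>1 + q \<alpha>, p\<^sub>2 + q \<beta>, q)\<close> form a lattice of determinant 1. By sign changes of \<open>\<alpha>\<close> and
  \<open>\<beta>\<close> it suffices to count its points in \<open>0 < x, y \<le> T\<close>, \<open>x y < \<epsilon>\<close>, \<open>0 < z \<le> Q\<close>. This region is cut
  into \<open>0 < x \<le> \<epsilon> / T\<close> and about \<open>ln (T\<^sup>2 / \<epsilon>)\<close> slabs \<open>a < x \<le> b\<close> with \<open>b / a \<le> e\<close>. Each slab is the
  difference of two convex sets, a box with sides \<open>b, c, Q\<close>, where \<open>b c \<le> 3 \<epsilon>\<close>, and the part of the box above the hyperbola.

  There are no points if \<open>\<epsilon> Q < \<phi> Q\<close>. Otherwise rescale the box to the unit cube. The hypothesis on \<open>\<phi>\<close> then gives a lower bound \<open>\<mu>\<close> of order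
  \<open>(\<epsilon> Q / \<phi> Q) powr (-1/3) / (1 + T)\<close> for the norm of a nonzero lattice vector; the factor
  \<open>1 + T\<close> is due to the vectors with \<open>q = 0\<close>. In a reduced basis the coordinates of the
  points of the unit cube are at most of order \<open>1 / \<mu>\<close>, so the number of lattice points in a convex subset
  differs from the normalised volume by at most the number of fundamental cells that meet its
  boundary, which is of order \<open>1 / \<mu>\<^sup>2\<close>.
\<close>

section \<open>Reduced bases of lattices\<close>

lemma card_vec_box:
  fixes A :: "'n::finite \<Rightarrow> 'a set"
  shows "card {x :: 'a^'n. \<forall>i. x $ i \<in> A i} = (\<Prod>i\<in>UNIV. card (A i))"
proof -
  have "bij_betw (\<lambda>f. \<chi> i. f i) (PiE UNIV A) {x :: 'a^'n. \<forall>i. x $ i \<in> A i}"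
    by (rule bij_betwI[of _ _ _ "\<lambda>x i. x $ i"]) (auto simp: vec_lambda_eta)
  from bij_betw_same_card[OF this] show ?thesis by (simp add: card_PiE)
qed

lemma finite_vec_box:
  fixes A :: "'n::finite \<Rightarrow> 'a set"
  assumes "\<And>i. finite (A i)"
  shows "finite {x :: 'a^'n. \<forall>i. x $ i \<in> A i}"
proof (rule finite_subset)
  show "{x :: 'a^'n. \<forall>i. x $ i \<in> A i} \<subseteq> (\<lambda>f. \<chi> i. f i) ` (PiE UNIV A)"
  proof
    fix x :: "'a^'n" assume "x \<in> {x. \<forall>i. x $ i \<in> A i}"
    then show "x \<in> (\<lambda>f. \<chi> i. f i) ` (PiE UNIV A)"
      by (intro image_eqI[of _ _ "\<lambda>i. x $ i"]) auto
  qed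
  show "finite ((\<lambda>f. \<chi> i. f i) ` (PiE UNIV A))"
    by (intro finite_imageI finite_PiE) (auto simp: assms)
qed

text \<open>The bracket is the determinant of the Gram matrix with diagonal \<open>a\<close>,
  \<open>b\<close>, \<open>c\<close> and off-diagonal entries \<open>d\<close>, \<open>e\<close>,
  \<open>f\<close>. If \<open>d * e * f\<close> is not negative, each of the three square terms is
  at most a quarter of \<open>a * b * c\<close>. Otherwise \<open>combo\<close> bounds their sum by
  a half, and the cubic term costs at most a further quarter.\<close>

lemma gram_det_lower_bound_sorted:
  fixes a b c d e f :: real
  assumes "0 < a" "a \<le> b" "b \<le> c" "2 * \<bar>f\<bar> \<le> a" "2 * \<bar>e\<bar> \<le> a" "2 * \<bar>d\<bar> \<le> b"
    and combo: "d * e * f < 0 \<Longrightarrow> 2 * (\<bar>d\<bar> + \<bar>e\<bar> + \<bar>f\<bar>) \<le> a + b"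
  shows "a * b * c \<le> 4 * (a * b * c + 2 * d * e * f - a * d\<^sup>2 - b * e\<^sup>2 - c * f\<^sup>2)"
proof -
  have pos: "0 < b" "0 < c" using assms by auto
  have sq: "x\<^sup>2 \<le> y * \<bar>x\<bar> / 2" if "2 * \<bar>x\<bar> \<le> y" for x y :: real
    using mult_right_mono[OF that, of "\<bar>x\<bar>"] by (simp add: power2_eq_square)
  show ?thesis
  proof (cases "d * e * f < 0")
    case True
    define D E F where "D = \<bar>d\<bar>" and "E = \<bar>e\<bar>" and "F = \<bar>f\<bar>"
    have nn: "0 \<le> D" "0 \<le> E" "0 \<le> F" by (auto simp: D_def E_def F_def)
    have s: "2 * (D + E + F) \<le> a + b" "2 * F \<le> a" "2 * E \<le> a" "2 * D \<le> b"
      using combo[OF True] assms by (auto simp: D_def E_def F_def)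
    have def: "d * e * f = - (D * E * F)"
      using True unfolding D_def E_def F_def by (simp add: abs_mult[symmetric])
    have "a * d\<^sup>2 \<le> a * (b * D / 2)"
      using sq[of d b] assms by (intro mult_left_mono) (auto simp: D_def)
    also have "\<dots> \<le> a * (c * D / 2)"
      using assms nn pos by (intro mult_left_mono divide_right_mono mult_right_mono) auto
    finally have 1: "a * d\<^sup>2 \<le> a * c * D / 2" by simp
    have "b * e\<^sup>2 \<le> b * (a * E / 2)"
      using sq[of e a] assms pos by (intro mult_left_mono) (auto simp: E_def)
    also have "\<dots> \<le> c * (a * E / 2)"
      using assms nn pos by (intro mult_right_mono) auto
    finally have 2: "b * e\<^sup>2 \<le> a * c * E / 2" by (simp add: mult_ac)
    have "c * f\<^sup>2 \<le> c * (a * F / 2)"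
      using sq[of f a] assms pos by (intro mult_left_mono) (auto simp: F_def)
    hence 3: "c * f\<^sup>2 \<le> a * c * F / 2" by (simp add: mult_ac)
    have "(2 * D) * (2 * E) * (2 * F) \<le> b * a * a"
      using s nn assms pos by (intro mult_mono) auto
    also have "\<dots> \<le> a * b * c" using assms pos by (simp add: mult_ac mult_left_mono)
    finally have 4: "2 * (D * E * F) \<le> a * b * c / 4" by simp
    \<comment> \<open>The sum of the three square bounds is linear in \<open>D + E + F\<close>,
      which by \<open>combo\<close> and \<open>a <= b\<close> is at most \<open>b\<close>.\<close>
    have "a * c * (D + E + F) \<le> a * c * ((a + b) / 2)"
      using s assms pos by (intro mult_left_mono) auto
    also have "\<dots> \<le> a * c * b" using assms pos by (intro mult_left_mono) auto
    finally have 5: "a * c * D / 2 + a * c * E / 2 + a * c * F / 2 \<le> a * b * c / 2"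
      by (simp add: algebra_simps)
    show ?thesis using 1 2 3 4 5 def by (simp add: algebra_simps)
  next
    case False
    have "a * d\<^sup>2 \<le> a * (b * (b / 2) / 2)"
      using order_trans[OF sq[of d b] divide_right_mono[OF mult_left_mono[of "\<bar>d\<bar>" "b/2" b]]] assms pos
      by (intro mult_left_mono) auto
    also have "\<dots> \<le> a * (b * (c / 2) / 2)"
      using assms pos by (intro mult_left_mono divide_right_mono) auto
    finally have 1: "a * d\<^sup>2 \<le> a * b * c / 4" by simp
    have "b * e\<^sup>2 \<le> b * (a * (a / 2) / 2)"
      using order_trans[OF sq[of e a] divide_right_mono[OF mult_left_mono[of "\<bar>e\<bar>" "a/2" a]]] assms pos
      by (intro mult_left_mono) auto
    also have "\<dots> \<le> b * (a * (c / 2) / 2)"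
      using assms pos by (intro mult_left_mono divide_right_mono) auto
    finally have 2: "b * e\<^sup>2 \<le> a * b * c / 4" by (simp add: mult_ac)
    have "c * f\<^sup>2 \<le> c * (a * (a / 2) / 2)"
      using order_trans[OF sq[of f a] divide_right_mono[OF mult_left_mono[of "\<bar>f\<bar>" "a/2" a]]] assms pos
      by (intro mult_left_mono) auto
    also have "\<dots> \<le> c * (a * (b / 2) / 2)"
      using assms pos by (intro mult_left_mono divide_right_mono) auto
    finally have 3: "c * f\<^sup>2 \<le> a * b * c / 4" by (simp add: mult_ac)
    show ?thesis using 1 2 3 False by (simp add: algebra_simps)
  qed
qed

text \<open>The determinant is unchanged when the indices are permuted, so each of the six orders of
  \<open>a\<close>, \<open>b\<close>, \<open>c\<close> reduces to the sorted case. The minimum in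
  \<open>combo\<close> covers whichever two of them are smallest.\<close>

lemma gram_det_lower_bound:
  fixes a b c d e f :: real
  assumes pos: "0 < a" "0 < b" "0 < c"
    and f: "2 * \<bar>f\<bar> \<le> a" "2 * \<bar>f\<bar> \<le> b"
    and e: "2 * \<bar>e\<bar> \<le> a" "2 * \<bar>e\<bar> \<le> c"
    and d: "2 * \<bar>d\<bar> \<le> b" "2 * \<bar>d\<bar> \<le> c"
    and combo: "d * e * f < 0 \<Longrightarrow> 2 * (\<bar>d\<bar> + \<bar>e\<bar> + \<bar>f\<bar>) \<le> min (a + b) (min (a + c) (b + c))"
  shows "a * b * c \<le> 4 * (a * b * c + 2 * d * e * f - a * d\<^sup>2 - b * e\<^sup>2 - c * f\<^sup>2)"
proof -
  consider "a \<le> b" "b \<le> c" | "a \<le> c" "c \<le> b" | "b \<le> a" "a \<le> c" | "b \<le> c" "c \<le> a"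
    | "c \<le> a" "a \<le> b" | "c \<le> b" "b \<le> a" by linarith
  then show ?thesis
  proof cases
    case 1 then show ?thesis using gram_det_lower_bound_sorted[of a b c f e d] assms by simp
  next
    case 2 then show ?thesis using gram_det_lower_bound_sorted[of a c b e f d] assms
      by (simp add: mult_ac add_ac)
  next
    case 3 then show ?thesis using gram_det_lower_bound_sorted[of b a c f d e] assms
      by (simp add: mult_ac add_ac)
  next
    case 4 then show ?thesis using gram_det_lower_bound_sorted[of b c a d f e] assms
      by (simp add: mult_ac add_ac)
  next
    case 5 then show ?thesis using gram_det_lower_bound_sorted[of c a b e d f] assms
      by (simp add: mult_ac add_ac)
  next
    case 6 then show ?thesis using gram_det_lower_bound_sorted[of c b a d e f] assms
      by (simp add: mult_ac add_ac)
  qed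
qed

section \<open>Lattices spanned by the rows of a matrix, and changes of basis\<close>

definition int_comb :: "real^'n^'n \<Rightarrow> int^'n \<Rightarrow> real^'n" where
  "int_comb u z = (\<Sum>i\<in>UNIV. of_int (z $ i) *\<^sub>R (u $ i))"

definition lattice_of :: "real^'n^'n \<Rightarrow> (real^'n) set" where
  "lattice_of u = range (int_comb u)"

lemma lattice_row: "u $ i \<in> lattice_of u"
proof -
  have "int_comb u (\<chi> k. if k = i then 1 else 0) = u $ i"
    by (simp add: int_comb_def if_distrib[of of_int] if_distrib[of "\<lambda>r. r *\<^sub>R _"] cong: if_cong)
  then show ?thesis unfolding lattice_of_def by (metis rangeI)
qed

lemma lattice_add: "x \<in> lattice_of u \<Longrightarrow> y \<in> lattice_of u \<Longrightarrow> x + y \<in> lattice_of u"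
proof -
  have "int_comb u z + int_comb u w = int_comb u (z + w)" for z w
    by (simp add: int_comb_def sum.distrib scaleR_left_distrib)
  then show "x \<in> lattice_of u \<Longrightarrow> y \<in> lattice_of u \<Longrightarrow> x + y \<in> lattice_of u"
    unfolding lattice_of_def by (auto simp: image_iff)
qed

lemma lattice_of_int_scaleR: "x \<in> lattice_of u \<Longrightarrow> of_int m *\<^sub>R x \<in> lattice_of u"
proof -
  have "of_int m *\<^sub>R int_comb u z = int_comb u (\<chi> i. m * z $ i)" for z
    by (simp add: int_comb_def scaleR_right.sum)
  then show "x \<in> lattice_of u \<Longrightarrow> of_int m *\<^sub>R x \<in> lattice_of u"
    unfolding lattice_of_def by (auto simp: image_iff)
qed

lemma lattice_sum:
  assumes "\<And>i. i \<in> I \<Longrightarrow> x i \<in> lattice_of u"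
  shows "(\<Sum>i\<in>I. of_int (m i) *\<^sub>R x i) \<in> lattice_of u"
proof -
  have "0 \<in> lattice_of u" using lattice_of_int_scaleR[OF lattice_row, of 0] by simp
  then show ?thesis using assms
    by (induction I rule: infinite_finite_induct) (auto intro: lattice_add lattice_of_int_scaleR)
qed

lemma lattice_subset_lattice:
  assumes "\<And>i. v $ i \<in> lattice_of u"
  shows "lattice_of v \<subseteq> lattice_of u"
proof -
  have "int_comb v z \<in> lattice_of u" for z
    unfolding int_comb_def by (rule lattice_sum) (rule assms)
  then show ?thesis by (auto simp: lattice_of_def)
qed

text \<open>The elementary move of the reduction. It is undone by subtracting the same combination,
  whose rows have not changed because \<open>i\<close> is not in \<open>J\<close>.\<close>

lemma lattice_row_operation:
  fixes u :: "real^'n^'n" and i :: 'n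
  defines "v w \<equiv> (\<chi> k. if k = i then u $ i + w else u $ k)"
  assumes w: "w = (\<Sum>j\<in>J. of_int (m j) *\<^sub>R u $ j)" and J: "i \<notin> J"
  shows "lattice_of (v w) = lattice_of u" and "det (v w) = det u"
proof -
  have vk: "v w $ k = u $ k" if "k \<noteq> i" for k using that by (simp add: v_def)
  have vi: "v w $ i = u $ i + w" by (simp add: v_def)
  have "v w $ k \<in> lattice_of u" for k
    unfolding v_def w by (simp add: lattice_add lattice_row lattice_sum)
  moreover have "u $ k \<in> lattice_of (v w)" for k
  proof (cases "k = i")
    case True
    have "w = (\<Sum>j\<in>J. of_int (m j) *\<^sub>R v w $ j)"
      using J unfolding w by (intro sum.cong) (auto simp: v_def)
    then have "of_int (-1) *\<^sub>R w \<in> lattice_of (v w)"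
      by (metis lattice_of_int_scaleR lattice_sum lattice_row)
    then have "v w $ i + of_int (-1) *\<^sub>R w \<in> lattice_of (v w)"
      by (intro lattice_add lattice_row)
    then show ?thesis using True by (simp add: vi)
  next
    case False then show ?thesis using vk[OF False] lattice_row[of "v w" k] by simp
  qed
  ultimately show "lattice_of (v w) = lattice_of u"
    using lattice_subset_lattice by blast
  have "w \<in> vec.span {row j u |j. j \<noteq> i}"
    unfolding w using J
    unfolding scalar_mult_eq_scaleR[symmetric]
    by (intro vec.span_sum vec.span_scale vec.span_base) (auto simp: row_def vec_lambda_eta)
  then have "det (\<chi> k. if k = i then row i u + w else row k u) = det u"
    by (rule det_row_span)
  then show "det (v w) = det u" by (simp add: v_def row_def cong: if_cong)
qed

lemma int_comb_eq: "int_comb u z = (\<chi> i. of_int (z $ i)) v* u"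
  by (simp add: int_comb_def vec_eq_iff vector_matrix_mult_def mult.commute)

text \<open>An injective linear map is bounded below, so a bound on the norm of a lattice vector
  bounds its integer coordinates.\<close>

lemma finite_lattice_cball:
  fixes u :: "real^'n^'n"
  assumes "det u \<noteq> 0"
  shows "finite (lattice_of u \<inter> cball 0 r)"
proof -
  define f where "f = (\<lambda>x. transpose u *v x)"
  have lin: "linear f" unfolding f_def by (rule matrix_vector_mul_linear)
  have "det (matrix f) \<noteq> 0"
    using assms unfolding f_def matrix_of_matrix_vector_mul det_transpose .
  then have "inj f" using det_nz_iff_inj[OF lin] by simp
  then obtain B where B: "B > 0" "\<And>x. B * norm x \<le> norm (f x)"
    using linear_inj_bounded_below_pos[OF lin] by metis
  let ?Z = "{z::int^'n. \<forall>i. z $ i \<in> {-\<lceil>r/B\<rceil>..\<lceil>r/B\<rceil>}}"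
  have "lattice_of u \<inter> cball 0 r \<subseteq> int_comb u ` ?Z"
  proof
    fix x assume "x \<in> lattice_of u \<inter> cball 0 r"
    then obtain z where z: "x = int_comb u z" and r: "norm x \<le> r" by (auto simp: lattice_of_def)
    define t :: "real^'n" where "t = (\<chi> i. of_int (z $ i))"
    have "B * norm t \<le> r" using B(2)[of t] r by (simp add: z int_comb_eq f_def t_def)
    then have "norm t \<le> r / B" using B(1) by (simp add: field_simps)
    then have "\<bar>real_of_int (z $ i)\<bar> \<le> r / B" for i
      using component_le_norm_cart[of t i] by (simp add: t_def)
    then have "z \<in> ?Z"
      by (auto simp: abs_le_iff) (smt (verit) le_of_int_ceiling of_int_le_iff of_int_minus)+
    then show "x \<in> int_comb u ` ?Z" using z by blast
  qed
  moreover have "finite ?Z" by (rule finite_vec_box) simp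
  ultimately show ?thesis using finite_surj by blast
qed

text \<open>Take a basis with the least sum of squared lengths. A row operation changes only one
  summand, so it cannot shorten that row.\<close>

lemma exists_minimal_basis:
  fixes u0 :: "real^'n^'n"
  assumes "det u0 \<noteq> 0"
  obtains u where "lattice_of u = lattice_of u0" "\<bar>det u\<bar> = \<bar>det u0\<bar>"
    "\<And>i J m. i \<notin> J \<Longrightarrow> norm (u $ i) \<le> norm (u $ i + (\<Sum>j\<in>J. of_int (m j) *\<^sub>R u $ j))"
proof -
  define F where "F u = (\<Sum>i\<in>UNIV. (norm (u $ i))\<^sup>2)" for u :: "real^'n^'n"
  \<comment> \<open>The condition on \<open>F\<close> confines the rows to a ball, which makes
    \<open>S\<close> finite and the minimum attained.\<close>
  define S where "S = {u. lattice_of u = lattice_of u0 \<and> \<bar>det u\<bar> = \<bar>det u0\<bar> \<and> F u \<le> F u0}"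
  have le: "norm (u $ i) \<le> sqrt (F u)" for u i
    unfolding F_def by (rule real_le_rsqrt, rule member_le_sum) auto
  have "S \<subseteq> {u. \<forall>i. u $ i \<in> lattice_of u0 \<inter> cball 0 (sqrt (F u0))}"
  proof safe
    fix u i assume u: "u \<in> S"
    then show "u $ i \<in> lattice_of u0" using lattice_row[of u i] by (auto simp: S_def)
    have "sqrt (F u) \<le> sqrt (F u0)" using u by (simp add: S_def)
    then show "u $ i \<in> cball 0 (sqrt (F u0))" using order_trans[OF le[of u i]] by simp
  qed
  then have fin: "finite S"
    using finite_vec_box[OF finite_lattice_cball[OF assms]] by (rule finite_subset)
  have "u0 \<in> S" by (simp add: S_def)
  then obtain u where uS: "u \<in> S" and min: "\<And>v. v \<in> S \<Longrightarrow> F u \<le> F v"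
    using ex_min_if_finite[of "F ` S"] fin by (auto simp: not_less)
  show ?thesis
  proof
    show "lattice_of u = lattice_of u0" "\<bar>det u\<bar> = \<bar>det u0\<bar>" using uS by (auto simp: S_def)
  next
    fix i and J :: "'n set" and m :: "'n \<Rightarrow> int" assume i: "i \<notin> J"
    define w where "w = (\<Sum>j\<in>J. of_int (m j) *\<^sub>R u $ j)"
    define v where "v = (\<chi> k. if k = i then u $ i + w else u $ k)"
    have lv: "lattice_of v = lattice_of u" "det v = det u"
      unfolding v_def using lattice_row_operation[OF w_def i] by auto
    have "F u \<le> F v"
    \<comment> \<open>If \<open>v\<close> fails the bound defining \<open>S\<close>, then
      \<open>F u <= F u0 < F v\<close> anyway.\<close>
    proof (cases "F v \<le> F u0")
      case True
      then show ?thesis using uS lv by (intro min) (auto simp: S_def)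
    qed (use uS in \<open>auto simp: S_def\<close>)
    then have "(norm (u $ i))\<^sup>2 \<le> (norm (u $ i + w))\<^sup>2"
      unfolding F_def by (subst (asm) (1 2) sum.remove[of UNIV i]) (auto simp: v_def)
    then show "norm (u $ i) \<le> norm (u $ i + (\<Sum>j\<in>J. of_int (m j) *\<^sub>R u $ j))"
      by (simp add: w_def)
  qed
qed

lemma det_power2_gram_3:
  fixes u :: "real^3^3"
  shows "(det u)\<^sup>2 = (u$1 \<bullet> u$1) * (u$2 \<bullet> u$2) * (u$3 \<bullet> u$3)
    + 2 * (u$2 \<bullet> u$3) * (u$1 \<bullet> u$3) * (u$1 \<bullet> u$2)
    - (u$1 \<bullet> u$1) * (u$2 \<bullet> u$3)\<^sup>2 - (u$2 \<bullet> u$2) * (u$1 \<bullet> u$3)\<^sup>2 - (u$3 \<bullet> u$3) * (u$1 \<bullet> u$2)\<^sup>2"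
proof -
  have "(det u)\<^sup>2 = det (u ** transpose u)"
    by (simp add: det_mul power2_eq_square)
  also have "u ** transpose u = (\<chi> i j. u $ i \<bullet> u $ j)"
    by (simp add: matrix_matrix_mult_def transpose_def inner_vec_def vec_eq_iff)
  finally show ?thesis
    by (simp add: det_3 inner_commute[of "u$2" "u$1"] inner_commute[of "u$3" "u$1"]
      inner_commute[of "u$3" "u$2"] power2_eq_square algebra_simps)
qed

text \<open>For a minimal basis, comparing \<open>u $ i\<close> with \<open>u $ i\<close> plus or
  minus one or two other rows yields the inequalities on the inner products that the Gram
  determinant bound needs. The factor 2 is the square root of the 4 there.\<close>

lemma reduced_basis_3:
  fixes u0 :: "real^3^3"
  assumes "det u0 \<noteq> 0"
  obtains u where "lattice_of u = lattice_of u0" "\<bar>det u\<bar> = \<bar>det u0\<bar>"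
    "norm (u $ 1) * norm (u $ 2) * norm (u $ 3) \<le> 2 * \<bar>det u\<bar>"
proof (rule exists_minimal_basis[OF assms])
  fix u assume u: "lattice_of u = lattice_of u0" "\<bar>det u\<bar> = \<bar>det u0\<bar>"
    and min: "\<And>i J m. i \<notin> J \<Longrightarrow> norm (u $ i) \<le> norm (u $ i + (\<Sum>j\<in>J. of_int (m j) *\<^sub>R u $ j))"
  define g where "g i j = u $ i \<bullet> u $ j" for i j
  have sym: "g i j = g j i" for i j by (simp add: g_def inner_commute)
  have m2: "2 * \<bar>g i j\<bar> \<le> g j j" if "i \<noteq> j" for i j
  proof -
    have "0 \<le> 2 * s * g i j + g j j" if s: "s = 1 \<or> s = -1" for s
    proof -
      have "norm (u $ i) \<le> norm (u $ i + s *\<^sub>R u $ j)"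
        using min[of i "{j}" "\<lambda>_. 1"] min[of i "{j}" "\<lambda>_. -1"] s \<open>i \<noteq> j\<close> by auto
      then have "(norm (u $ i))\<^sup>2 \<le> (norm (u $ i + s *\<^sub>R u $ j))\<^sup>2" by simp
      then show ?thesis using s
        by (auto simp: power2_norm_eq_inner inner_add_left inner_add_right inner_diff_left
            inner_diff_right g_def inner_commute)
    qed
    from this[of 1] this[of "-1"] show ?thesis by linarith
  qed
  have m3: "0 \<le> g j j + g k k + 2 * s * g i j + 2 * t * g i k + 2 * s * t * g j k"
    if "i \<noteq> j" "i \<noteq> k" "j \<noteq> k" and st: "s = 1 \<or> s = -1" "t = 1 \<or> t = -1" for i j k s t
  proof -
    obtain s' t' :: int where st': "s = of_int s'" "t = of_int t'"
      using st by (metis of_int_1 of_int_minus)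
    have "norm (u $ i) \<le> norm (u $ i + (s *\<^sub>R u $ j + t *\<^sub>R u $ k))"
      using min[of i "{j,k}" "\<lambda>x. if x = j then s' else t'"] that(1-3) st' by auto
    then have "(norm (u $ i))\<^sup>2 \<le> (norm (u $ i + (s *\<^sub>R u $ j + t *\<^sub>R u $ k)))\<^sup>2" by simp
    then show ?thesis using st
      by (auto simp: power2_norm_eq_inner inner_add_left inner_add_right inner_diff_left
            inner_diff_right g_def inner_commute algebra_simps)
  qed
  have pos: "0 < g i i" for i
  proof -
    have "det u \<noteq> 0" using u(2) assms by auto
    then have "u $ i \<noteq> 0" using det_zero_row(1)[of i u] by (auto simp: row_def vec_lambda_eta)
    then show ?thesis by (simp add: g_def)
  qed
  have combo: "2 * (\<bar>g 2 3\<bar> + \<bar>g 1 3\<bar> + \<bar>g 1 2\<bar>) \<le> min (g 1 1 + g 2 2) (min (g 1 1 + g 3 3) (g 2 2 + g 3 3))"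
    if neg: "g 2 3 * g 1 3 * g 1 2 < 0"
  proof -
    \<comment> \<open>The bound for the pair \<open>j\<close>, \<open>k\<close> comes from altering
      the third vector \<open>i\<close> by both of them.\<close>
    have *: "2 * (\<bar>g 2 3\<bar> + \<bar>g 1 3\<bar> + \<bar>g 1 2\<bar>) \<le> g j j + g k k"
      if ijk: "i \<noteq> j" "i \<noteq> k" "j \<noteq> k" and e: "\<bar>g 2 3\<bar> + \<bar>g 1 3\<bar> + \<bar>g 1 2\<bar> = \<bar>g i j\<bar> + \<bar>g i k\<bar> + \<bar>g j k\<bar>"
        and p: "g 2 3 * g 1 3 * g 1 2 = g i j * g i k * g j k" for i j k
    proof -
      have neg': "g i j * g i k * g j k < 0" using neg p by simp
      have n: "g i j \<noteq> 0" "g i k \<noteq> 0" "g j k \<noteq> 0" using neg' by auto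
      \<comment> \<open>These signs make \<open>s * g i j\<close> and \<open>t * g i k\<close>
        negative. Since the product of the three inner products is negative,
        \<open>s * t * g j k\<close> is then negative too, and \<open>m3\<close> bounds the sum of
        all three absolute values.\<close>
      define s t :: real where "s = - sgn (g i j)" and "t = - sgn (g i k)"
      have st: "s = 1 \<or> s = -1" "t = 1 \<or> t = -1" using n by (auto simp: s_def t_def sgn_if)
      have "s * t * g j k = - \<bar>g j k\<bar>" "s * g i j = - \<bar>g i j\<bar>" "t * g i k = - \<bar>g i k\<bar>"
        using neg' n by (auto simp: s_def t_def sgn_if mult_less_0_iff zero_less_mult_iff abs_if)
      then show ?thesis using m3[OF ijk st] e by simp
    qed
    show ?thesis using *[of 1 2 3] *[of 2 1 3] *[of 3 1 2] sym[of 3 1] sym[of 3 2] sym[of 2 1]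
      by (simp add: mult_ac)
  qed
  have "g 1 1 * g 2 2 * g 3 3 \<le> 4 * (g 1 1 * g 2 2 * g 3 3 + 2 * g 2 3 * g 1 3 * g 1 2
      - g 1 1 * (g 2 3)\<^sup>2 - g 2 2 * (g 1 3)\<^sup>2 - g 3 3 * (g 1 2)\<^sup>2)"
    using pos m2[of 1 2] m2[of 2 1] m2[of 1 3] m2[of 3 1] m2[of 2 3] m2[of 3 2]
      sym[of 3 1] sym[of 3 2] sym[of 2 1] combo
    by (intro gram_det_lower_bound) simp_all
  also have "\<dots> = 4 * (det u)\<^sup>2" by (simp add: det_power2_gram_3 g_def)
  finally have "(norm (u $ 1) * norm (u $ 2) * norm (u $ 3))\<^sup>2 \<le> (2 * \<bar>det u\<bar>)\<^sup>2"
    by (simp add: power_mult_distrib power2_norm_eq_inner g_def)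
  then have "norm (u $ 1) * norm (u $ 2) * norm (u $ 3) \<le> 2 * \<bar>det u\<bar>"
    by (rule power2_le_imp_le) simp
  with u show ?thesis using that by blast
qed

section \<open>Integer points in convex sets\<close>

text \<open>Flat sets are included: a convex set without interior lies in a hyperplane, which
  supports it at each of its frontier points. Otherwise \<open>p\<close> is separated from the
  interior, whose closure is that of \<open>K\<close>.\<close>

lemma supporting_hyperplane_frontier:
  fixes K :: "'a::euclidean_space set"
  assumes "convex K" "p \<in> frontier K"
  obtains a where "a \<noteq> 0" "\<And>x. x \<in> closure K \<Longrightarrow> a \<bullet> x \<le> a \<bullet> p"
proof (cases "interior K = {}")
  case True
  obtain a b where ab: "a \<noteq> 0" "K \<subseteq> {x. a \<bullet> x = b}"
    using empty_interior_subset_hyperplane[OF \<open>convex K\<close> True] by metis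
  have "closure K \<subseteq> {x. a \<bullet> x = b}"
    using ab(2) by (rule closure_minimal) (rule closed_hyperplane)
  then have "a \<bullet> x = b" if "x \<in> closure K" for x using that by auto
  moreover have "p \<in> closure K" using assms by (simp add: frontier_def)
  ultimately show ?thesis using ab(1) by (intro that[of a]) auto
next
  case False
  have "interior K \<inter> {p} = {}" using assms by (auto simp: frontier_def)
  then obtain a b where ab: "a \<noteq> 0" "\<forall>x\<in>interior K. a \<bullet> x \<le> b" "b \<le> a \<bullet> p"
    using separating_hyperplane_sets[of "interior K" "{p}"] False assms(1)
    by (auto simp: convex_interior)
  have "closure (interior K) \<subseteq> {x. a \<bullet> x \<le> b}"
    using ab(2) by (intro closure_minimal closed_halfspace_le) auto
  then show ?thesis
    using that[of a] ab convex_closure_interior[OF assms(1) False] by force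
qed

text \<open>Half-open, so that the cubes tile the space and each contains exactly one integer point,
  its corner \<open>z\<close>.\<close>

definition unit_cube :: "int^'n \<Rightarrow> (real^'n) set" where
  "unit_cube z = {t. \<forall>i. of_int (z $ i) \<le> t $ i \<and> t $ i < of_int (z $ i) + 1}"

lemma convex_unit_cube: "convex (unit_cube z)"
proof -
  have "unit_cube z = (\<Inter>i. {t. axis i 1 \<bullet> t \<ge> of_int (z $ i)} \<inter> {t. axis i 1 \<bullet> t < of_int (z $ i) + 1})"
    by (auto simp: unit_cube_def inner_axis')
  then show ?thesis
    by (simp only:) (intro convex_INT convex_Int convex_halfspace_ge convex_halfspace_lt)
qed

text \<open>In the inner product of \<open>\<nu>\<close> with \<open>q - p\<close>, which is not
  positive, the coordinates other than \<open>i\<close> contribute at most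
  \<open>\<bar>\<nu> $ i\<bar>\<close> each. Dividing by \<open>\<bar>\<nu> $ i\<bar>\<close> bounds
  the displacement in direction \<open>i\<close>.\<close>

lemma same_column_close:
  fixes p q \<nu> :: "real^'n" and i :: 'n
  assumes "\<nu> \<noteq> 0" and dom: "\<And>j. \<bar>\<nu> $ j\<bar> \<le> \<bar>\<nu> $ i\<bar>" and le: "\<nu> \<bullet> q \<le> \<nu> \<bullet> p"
    and close: "\<And>j. j \<noteq> i \<Longrightarrow> \<bar>q $ j - p $ j\<bar> \<le> 1"
  shows "sgn (\<nu> $ i) * (q $ i - p $ i) \<le> CARD('n) - 1"
proof -
  have nz: "\<bar>\<nu> $ i\<bar> > 0"
  proof (rule ccontr)
    assume "\<not> \<bar>\<nu> $ i\<bar> > 0"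
    then have "\<bar>\<nu> $ j\<bar> \<le> 0" for j using dom[of j] by linarith
    then show False using \<open>\<nu> \<noteq> 0\<close> by (simp add: vec_eq_iff)
  qed
  have "\<nu> \<bullet> (q - p) = \<nu> $ i * (q $ i - p $ i) + (\<Sum>j\<in>UNIV - {i}. \<nu> $ j * (q $ j - p $ j))"
    by (simp add: inner_vec_def sum.remove[of UNIV i])
  moreover have "\<nu> \<bullet> (q - p) \<le> 0" using le by (simp add: inner_diff_right)
  moreover have "\<bar>\<Sum>j\<in>UNIV - {i}. \<nu> $ j * (q $ j - p $ j)\<bar> \<le> (\<Sum>j\<in>UNIV - {i}. \<bar>\<nu> $ i\<bar> * 1)"
    by (rule order_trans[OF sum_abs sum_mono])
      (use mult_mono[OF dom close] in \<open>auto simp: abs_mult\<close>)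
  ultimately have "\<nu> $ i * (q $ i - p $ i) \<le> \<bar>\<nu> $ i\<bar> * real (CARD('n) - 1)"
    by (simp add: card_Diff_singleton mult.commute)
  moreover have "\<nu> $ i * (q $ i - p $ i) = \<bar>\<nu> $ i\<bar> * (sgn (\<nu> $ i) * (q $ i - p $ i))"
    by (simp add: mult.assoc[symmetric] abs_mult_sgn mult.commute)
  ultimately show ?thesis using nz by (simp add: of_nat_diff)
qed

text \<open>
  Choose in every cube that meets the boundary a boundary point with a supporting normal, and sort
  the cubes by the dominant coordinate \<open>i\<close> of the normal and its sign. Two cubes of the same class in
  the same column of direction \<open>i\<close> have distance less than \<open>CARD('n)\<close>, since each of the two points lies
  below the supporting hyperplane of the other. So a cube is determined by its class, its column and
  its \<open>i\<close>-th coordinate modulo \<open>CARD('n)\<close>.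
\<close>

lemma card_boundary_cubes:
  fixes K :: "(real^'n) set" and m :: nat
  assumes "convex K"
  defines "B \<equiv> {z. unit_cube z \<inter> K \<noteq> {} \<and> \<not> unit_cube z \<subseteq> K}"
  assumes m: "\<And>z i. z \<in> B \<Longrightarrow> \<bar>z $ i\<bar> \<le> int m"
  shows "card B \<le> 2 * CARD('n)\<^sup>2 * (2 * m + 1) ^ (CARD('n) - 1)"
proof -
  let ?n = "CARD('n)"
  have "\<exists>p \<nu>. p \<in> unit_cube z \<and> p \<in> frontier K \<and> \<nu> \<noteq> 0 \<and> (\<forall>x\<in>closure K. \<nu> \<bullet> x \<le> \<nu> \<bullet> p)"
    if "z \<in> B" for z
  proof -
    \<comment> \<open>A cube is connected and contains points inside and outside
      \<open>K\<close>.\<close>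
    have "unit_cube z \<inter> frontier K \<noteq> {}"
      using that by (intro connected_Int_frontier convex_connected convex_unit_cube) (auto simp: B_def)
    then obtain p where p: "p \<in> unit_cube z" "p \<in> frontier K" by blast
    then show ?thesis using supporting_hyperplane_frontier[OF \<open>convex K\<close> p(2)] by metis
  qed
  then obtain p \<nu> where p: "\<And>z. z \<in> B \<Longrightarrow> p z \<in> unit_cube z" "\<And>z. z \<in> B \<Longrightarrow> p z \<in> frontier K"
    and \<nu>: "\<And>z. z \<in> B \<Longrightarrow> \<nu> z \<noteq> 0" "\<And>z x. z \<in> B \<Longrightarrow> x \<in> closure K \<Longrightarrow> \<nu> z \<bullet> x \<le> \<nu> z \<bullet> p z"
    by metis
  have "\<exists>i. \<forall>j. \<bar>\<nu> z $ j\<bar> \<le> \<bar>\<nu> z $ i\<bar>" for z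
  proof -
    let ?A = "range (\<lambda>j. \<bar>\<nu> z $ j\<bar>)"
    have "Max ?A \<in> ?A" by (rule Max_in) auto
    then obtain i where i: "Max ?A = \<bar>\<nu> z $ i\<bar>" by (rule imageE)
    have "\<bar>\<nu> z $ j\<bar> \<le> Max ?A" for j by (rule Max_ge) auto
    then show ?thesis unfolding i by blast
  qed
  then obtain d where d: "\<And>z j. \<bar>\<nu> z $ j\<bar> \<le> \<bar>\<nu> z $ d z\<bar>" by metis
  define C where "C i = (\<lambda>s::bool. {z \<in> B. d z = i \<and> (\<nu> z $ i > 0 \<longleftrightarrow> s)})" for i
  define h where "h i = (\<lambda>z. (\<chi> j. if j = i then z $ j mod int ?n else z $ j) :: int^'n)" for i
  define A where "A i = (\<lambda>j. if j = i then {0..<int ?n} else {- int m..int m})" for i :: 'n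
  have h_in: "h i ` C i s \<subseteq> {x. \<forall>j. x $ j \<in> A i j}" for i s
    using m by (auto simp: h_def A_def C_def abs_le_iff minus_le_iff)
  have "inj_on (h i) (C i s)" for i s
  proof (rule inj_onI)
    fix z w assume z: "z \<in> C i s" and w: "w \<in> C i s" and eq: "h i z = h i w"
    have zB: "z \<in> B" "w \<in> B" "d z = i" "d w = i" using z w by (auto simp: C_def)
    have nz: "\<nu> z $ i \<noteq> 0" "\<nu> w $ i \<noteq> 0"
      using \<nu>(1)[OF zB(1)] \<nu>(1)[OF zB(2)] d[of z] d[of w] zB(3,4) by (auto simp: vec_eq_iff)
    have sg: "sgn (\<nu> z $ i) = sgn (\<nu> w $ i)" using z w nz by (auto simp: C_def sgn_if)
    have off: "z $ j = w $ j" if "j \<noteq> i" for j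
      using arg_cong[OF eq, of "\<lambda>x. x $ j"] that by (simp add: h_def)
    have close: "\<bar>p z $ j - p w $ j\<bar> \<le> 1" if "j \<noteq> i" for j
      using p(1)[OF zB(1)] p(1)[OF zB(2)] off[OF that] by (auto simp: unit_cube_def dest!: spec[of _ j])
    have cl: "p z \<in> closure K" "p w \<in> closure K" using p(2) zB by (auto simp: frontier_def)
    have "sgn (\<nu> z $ i) * (p w $ i - p z $ i) \<le> ?n - 1"
      using zB close cl d[of z] by (intro same_column_close \<nu>) (auto simp: abs_minus_commute)
    moreover have "sgn (\<nu> w $ i) * (p z $ i - p w $ i) \<le> ?n - 1"
      using zB close cl d[of w] by (intro same_column_close \<nu>) (auto simp: abs_minus_commute)
    ultimately have "\<bar>p z $ i - p w $ i\<bar> \<le> ?n - 1"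
      using sg nz by (auto simp: sgn_if split: if_splits)
    moreover have "of_int (z $ i) \<le> p z $ i" "p z $ i < of_int (z $ i) + 1"
      "of_int (w $ i) \<le> p w $ i" "p w $ i < of_int (w $ i) + 1"
      using p(1)[OF zB(1)] p(1)[OF zB(2)] by (auto simp: unit_cube_def)
    moreover have "real (?n - 1) = real ?n - 1" by (simp add: of_nat_diff)
    \<comment> \<open>Each point exceeds its corner by less than 1, so the corners differ by
      strictly less than \<open>?n - 1 + 1\<close>. Congruence modulo \<open>?n\<close> then forces
      equality.\<close>
    ultimately have "\<bar>real_of_int (z $ i - w $ i)\<bar> < real ?n" by auto
    then have "\<bar>z $ i - w $ i\<bar> < int ?n" by linarith
    moreover have "int ?n dvd z $ i - w $ i"
      using arg_cong[OF eq, of "\<lambda>x. x $ i"] by (simp add: h_def mod_eq_dvd_iff)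
    ultimately have "z $ i = w $ i"
      by (metis abs_of_nat dvd_imp_le_int linorder_not_less right_minus_eq)
    with off show "z = w" by (metis vec_eq_iff)
  qed
  then have card_C: "card (C i s) \<le> ?n * (2 * m + 1) ^ (?n - 1)" for i s
  proof -
    have "card (C i s) \<le> card {x :: int^'n. \<forall>j. x $ j \<in> A i j}"
      using \<open>inj_on (h i) (C i s)\<close> h_in
      by (rule card_inj_on_le) (rule finite_vec_box, simp add: A_def)
    also have "\<dots> = (\<Prod>j\<in>UNIV. card (A i j))" by (rule card_vec_box)
    also have "\<dots> = ?n * (\<Prod>j\<in>UNIV - {i}. card (A i j))"
      by (subst prod.remove[of UNIV i]) (auto simp: A_def)
    also have "(\<Prod>j\<in>UNIV - {i}. card (A i j)) = (\<Prod>j\<in>UNIV - {i}. 2 * m + 1)"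
      by (rule prod.cong) (auto simp: A_def nat_add_distrib)
    finally show ?thesis by (simp add: card_Diff_singleton)
  qed
  have "finite B"
    by (rule finite_subset[OF _ finite_vec_box[of "\<lambda>_. {- int m..int m}"]])
      (use m in \<open>auto simp: abs_le_iff minus_le_iff\<close>)
  have "B \<subseteq> (\<Union>x\<in>UNIV. C (fst x) (snd x))" by (auto simp: C_def)
  then have "card B \<le> card (\<Union>x\<in>UNIV. C (fst x) (snd x))"
    by (intro card_mono finite_subset[OF _ \<open>finite B\<close>]) (auto simp: C_def)
  also have "\<dots> \<le> (\<Sum>x\<in>(UNIV :: ('n \<times> bool) set). card (C (fst x) (snd x)))"
    by (rule card_UN_le) simp
  also have "\<dots> \<le> (\<Sum>x\<in>(UNIV :: ('n \<times> bool) set). ?n * (2 * m + 1) ^ (?n - 1))"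
    by (rule sum_mono) (rule card_C)
  also have "\<dots> = 2 * ?n\<^sup>2 * (2 * m + 1) ^ (?n - 1)"
    by (simp add: power2_eq_square)
  finally show ?thesis .
qed

section \<open>Comparing the number of integer points with the volume\<close>

lemma disjoint_unit_cubes: "z \<noteq> w \<Longrightarrow> unit_cube z \<inter> unit_cube w = {}"
proof -
  have "z $ i = w $ i" if "t \<in> unit_cube z" "t \<in> unit_cube w" for t i
  proof -
    have "\<lfloor>t $ i\<rfloor> = z $ i" "\<lfloor>t $ i\<rfloor> = w $ i"
      using that by (auto simp: unit_cube_def floor_eq_iff)
    then show ?thesis by simp
  qed
  then show "z \<noteq> w \<Longrightarrow> unit_cube z \<inter> unit_cube w = {}" by (auto simp: vec_eq_iff)
qed

lemma in_unit_cube_floor: "t \<in> unit_cube (\<chi> i. \<lfloor>t $ i\<rfloor>)"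
  by (simp add: unit_cube_def)

lemma bounded_unit_cube: "bounded (unit_cube z)"
proof -
  have "unit_cube z \<subseteq> cbox (\<chi> i. of_int (z $ i)) (\<chi> i. of_int (z $ i) + 1)"
    by (auto simp: unit_cube_def mem_box_cart less_imp_le)
  then show ?thesis using bounded_cbox bounded_subset by blast
qed

lemma measure_unit_cube:
  fixes z :: "int^'n"
  shows "measure lebesgue (unit_cube z) = 1"
proof (rule antisym)
  let ?a = "(\<chi> i. of_int (z $ i)) :: real^'n" and ?b = "(\<chi> i. of_int (z $ i) + 1) :: real^'n"
  have lm: "unit_cube z \<in> lmeasurable"
    by (intro measurable_convex convex_unit_cube bounded_unit_cube)
  have "cbox ?a ?b \<noteq> {}" by (simp add: interval_ne_empty_cart)
  then have c: "measure lebesgue (cbox ?a ?b) = 1"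
    by (simp add: content_cbox_cart)
  have "measure lebesgue (unit_cube z) \<le> measure lebesgue (cbox ?a ?b)"
    using lm by (intro measure_mono_fmeasurable) (auto simp: unit_cube_def mem_box_cart less_imp_le)
  then show "measure lebesgue (unit_cube z) \<le> 1" by (simp only: c)
  have "measure lebesgue (box ?a ?b) = 1"
    using c by (simp add: measure_completion measure_lborel_box_eq measure_lborel_cbox_eq box_eq_empty)
  moreover have "measure lebesgue (box ?a ?b) \<le> measure lebesgue (unit_cube z)"
    using lm by (intro measure_mono_fmeasurable) (auto simp: unit_cube_def mem_box_cart less_imp_le)
  ultimately show "1 \<le> measure lebesgue (unit_cube z)" by simp
qed

text \<open>Compare cube by cube: a cube inside \<open>K\<close> contributes 1 to both the count and
  the volume, a cube disjoint from \<open>K\<close> contributes 0 to both, and only a cube meeting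
  the boundary can cause an error, of at most 1.\<close>

lemma integer_points_in_convex:
  fixes K :: "(real^'n) set" and m :: nat
  assumes "convex K" and m: "\<And>t i. t \<in> K \<Longrightarrow> \<bar>t $ i\<bar> \<le> real m"
  shows "\<bar>real (card {z::int^'n. (\<chi> i. of_int (z $ i)) \<in> K}) - measure lebesgue K\<bar>
    \<le> 2 * CARD('n)\<^sup>2 * (2 * m + 1) ^ (CARD('n) - 1)"
proof -
  define Z :: "(int^'n) set" where "Z = {z. \<forall>i. z $ i \<in> {- int m..int m}}"
  have finZ: "finite Z" unfolding Z_def by (rule finite_vec_box) simp
  have in_Z: "z \<in> Z" if t: "t \<in> unit_cube z" "t \<in> K" for z t
  proof -
    have "\<lfloor>t $ i\<rfloor> = z $ i" for i using t by (auto simp: unit_cube_def floor_eq_iff)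
    moreover have "\<bar>t $ i\<bar> \<le> real m" for i using m t by blast
    then have "- int m \<le> \<lfloor>t $ i\<rfloor>" "\<lfloor>t $ i\<rfloor> \<le> int m" for i
      using abs_le_iff[of "t $ i" "real m"]
      by (auto simp: le_floor_iff minus_le_iff floor_le_iff)
    ultimately show ?thesis by (auto simp: Z_def)
  qed
  let ?v = "\<lambda>z::int^'n. (\<chi> i. of_int (z $ i)) :: real^'n"
  have v_cube: "?v z \<in> unit_cube z" for z by (simp add: unit_cube_def)
  have bK: "bounded K"
  proof (rule bounded_subset)
    show "K \<subseteq> cbox (\<chi> i. - real m) (\<chi> i. real m)"
    proof
      fix t assume "t \<in> K"
      then have "\<bar>t $ i\<bar> \<le> real m" for i by (rule m)
      then show "t \<in> cbox (\<chi> i. - real m) (\<chi> i. real m)"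
        by (simp add: mem_box_cart abs_le_iff minus_le_iff)
    qed
  qed (rule bounded_cbox)
  have lm: "K \<inter> unit_cube z \<in> lmeasurable" for z
    using bK assms(1) by (intro measurable_convex convex_Int convex_unit_cube bounded_Int) auto
  have le1: "measure lebesgue (K \<inter> unit_cube z) \<le> 1" for z
    unfolding measure_unit_cube[of z, symmetric]
    by (intro measure_mono_fmeasurable fmeasurableD[OF lm] measurable_convex convex_unit_cube bounded_unit_cube) auto
  have "K = (\<Union>z\<in>Z. K \<inter> unit_cube z)" using in_Z[OF in_unit_cube_floor] in_unit_cube_floor by fast
  then have "measure lebesgue K = measure lebesgue (\<Union>z\<in>Z. K \<inter> unit_cube z)" by simp
  also have "\<dots> = (\<Sum>z\<in>Z. measure lebesgue (K \<inter> unit_cube z))"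
  proof (rule measure_finite_Union[OF finZ])
    show "(\<lambda>z. K \<inter> unit_cube z) ` Z \<subseteq> sets lebesgue" using lm fmeasurableD by blast
    show "disjoint_family_on (\<lambda>z. K \<inter> unit_cube z) Z"
      using disjoint_unit_cubes by (fastforce simp: disjoint_family_on_def)
    show "emeasure lebesgue (K \<inter> unit_cube z) \<noteq> \<infinity>" for z
      using fmeasurableD2[OF lm, of z] by simp
  qed
  finally have vol: "measure lebesgue K = (\<Sum>z\<in>Z. measure lebesgue (K \<inter> unit_cube z))" .
  have "{z. ?v z \<in> K} = {z\<in>Z. ?v z \<in> K}" using in_Z[OF v_cube] by blast
  then have cnt: "real (card {z. ?v z \<in> K}) = (\<Sum>z\<in>Z. if ?v z \<in> K then 1 else 0)"
    using finZ by (simp add: sum.If_cases Int_def)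
  define B where "B = {z. unit_cube z \<inter> K \<noteq> {} \<and> \<not> unit_cube z \<subseteq> K}"
  have BZ: "B \<subseteq> Z" using in_Z by (auto simp: B_def)
  have dif: "\<bar>(if ?v z \<in> K then 1 else 0) - measure lebesgue (K \<inter> unit_cube z)\<bar> \<le> (if z \<in> B then 1 else 0)" for z
  proof (cases "z \<in> B")
    case True
    then show ?thesis using le1[of z] measure_nonneg[of lebesgue "K \<inter> unit_cube z"] by auto
  next
    case False
    then consider "unit_cube z \<inter> K = {}" | "unit_cube z \<subseteq> K" by (auto simp: B_def)
    then show ?thesis
    proof cases
      case 1
      then have "?v z \<notin> K" "K \<inter> unit_cube z = {}" using v_cube by blast+
      then show ?thesis by simp
    next
      case 2
      then have "?v z \<in> K" "K \<inter> unit_cube z = unit_cube z" using v_cube by blast+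
      then show ?thesis by (simp add: measure_unit_cube)
    qed
  qed
  have "\<bar>real (card {z. ?v z \<in> K}) - measure lebesgue K\<bar> \<le> (\<Sum>z\<in>Z. if z \<in> B then 1 else 0)"
    unfolding cnt vol sum_subtractf[symmetric]
    by (rule order_trans[OF sum_abs sum_mono]) (rule dif)
  also have "\<dots> = real (card B)" using finZ BZ by (simp add: sum.If_cases Int_absorb1)
  also have "card B \<le> 2 * CARD('n)\<^sup>2 * (2 * m + 1) ^ (CARD('n) - 1)"
    unfolding B_def
  proof (rule card_boundary_cubes[OF assms(1)])
    fix z :: "int^'n" and i assume "z \<in> {z. unit_cube z \<inter> K \<noteq> {} \<and> \<not> unit_cube z \<subseteq> K}"
    then have "z \<in> Z" using BZ by (auto simp: B_def)
    then show "\<bar>z $ i\<bar> \<le> int m" by (auto simp: Z_def abs_le_iff minus_le_iff)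
  qed
  finally show ?thesis by (simp only: of_nat_le_iff)
qed

section \<open>Lattice points in convex sets of dimension three\<close>

lemma abs_triple_product_le:
  fixes x y z :: "real^3"
  shows "\<bar>x \<bullet> cross3 y z\<bar> \<le> norm x * (norm y * norm z)"
proof -
  have "(norm (cross3 y z))\<^sup>2 \<le> (norm y * norm z)\<^sup>2"
    by (simp add: norm_cross power_mult_distrib)
  then have "norm (cross3 y z) \<le> norm y * norm z" by (rule power2_le_imp_le) simp
  then show ?thesis
    using Cauchy_Schwarz_ineq2[of x "cross3 y z"] by (meson mult_left_mono norm_ge_zero order_trans)
qed

text \<open>Cramer's rule: the triple product of the vector with the two other rows is
  \<open>t $ i * det u\<close>. Bounding it by a product of norms and multiplying by
  \<open>norm (u $ i)\<close> brings in the reducedness of the basis, and the determinant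
  cancels.\<close>

lemma coordinate_bound_3:
  fixes u :: "real^3^3" and t :: "real^3"
  assumes det: "det u \<noteq> 0" and red: "norm (u $ 1) * norm (u $ 2) * norm (u $ 3) \<le> 2 * \<bar>det u\<bar>"
  shows "\<bar>t $ i\<bar> * norm (u $ i) \<le> 2 * norm (\<Sum>i\<in>UNIV. t $ i *\<^sub>R u $ i)"
proof -
  define x where "x = (\<Sum>i\<in>UNIV. t $ i *\<^sub>R u $ i)"
  have *: "\<bar>t $ i\<bar> * norm (u $ i) \<le> 2 * norm x"
    if c: "x \<bullet> cross3 (u $ j) (u $ k) = t $ i * d" and d: "\<bar>d\<bar> = \<bar>det u\<bar>"
      and r: "norm (u $ i) * (norm (u $ j) * norm (u $ k)) \<le> 2 * \<bar>det u\<bar>" for i j k d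
  proof -
    have "\<bar>t $ i\<bar> * \<bar>det u\<bar> \<le> norm x * (norm (u $ j) * norm (u $ k))"
      using abs_triple_product_le[of x "u $ j" "u $ k"] c d by (simp add: abs_mult)
    then have "\<bar>t $ i\<bar> * \<bar>det u\<bar> * norm (u $ i) \<le> norm x * (norm (u $ j) * norm (u $ k)) * norm (u $ i)"
      by (rule mult_right_mono) simp
    also have "\<dots> \<le> norm x * (2 * \<bar>det u\<bar>)"
      using mult_left_mono[OF r, of "norm x"] by (simp add: mult_ac)
    finally have "\<bar>det u\<bar> * (\<bar>t $ i\<bar> * norm (u $ i)) \<le> \<bar>det u\<bar> * (2 * norm x)" by (simp add: mult_ac)
    then show ?thesis using det by simp
  qed
  have "x \<bullet> cross3 (u $ 2) (u $ 3) = t $ 1 * det u" "x \<bullet> cross3 (u $ 3) (u $ 1) = t $ 2 * det u"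
    "x \<bullet> cross3 (u $ 1) (u $ 2) = t $ 3 * det u"
    by (simp_all add: x_def sum_3 cross3_def inner_vec_def det_3 algebra_simps)
  note c = this
  have "norm (u $ 1) * (norm (u $ 2) * norm (u $ 3)) \<le> 2 * \<bar>det u\<bar>"
    "norm (u $ 2) * (norm (u $ 3) * norm (u $ 1)) \<le> 2 * \<bar>det u\<bar>"
    "norm (u $ 3) * (norm (u $ 1) * norm (u $ 2)) \<le> 2 * \<bar>det u\<bar>"
    using red by (simp_all add: mult_ac)
  from *[OF c(1) refl this(1)] *[OF c(2) refl this(2)] *[OF c(3) refl this(3)]
  show ?thesis unfolding x_def using exhaust_3[of i] by auto
qed

text \<open>Coordinates in a reduced basis turn the lattice into the integer points and divide
  volumes by the determinant. Every basis vector has norm at least \<open>\<mu>\<close>, so the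
  preimage of \<open>K\<close> has coordinates at most \<open>2 * r / \<mu>\<close>. The 18 is
  \<open>2 * 3\<^sup>2\<close> from the boundary cubes.\<close>

lemma lattice_points_in_convex:
  fixes u0 :: "real^3^3" and K :: "(real^3) set"
  assumes det: "det u0 \<noteq> 0" and "0 < \<mu>" and \<mu>: "\<And>x. x \<in> lattice_of u0 \<Longrightarrow> x \<noteq> 0 \<Longrightarrow> \<mu> \<le> norm x"
    and "convex K" and r: "K \<subseteq> cball 0 r" "0 \<le> r"
  shows "\<bar>real (card (lattice_of u0 \<inter> K)) - measure lebesgue K / \<bar>det u0\<bar>\<bar> \<le> 18 * (4 * r / \<mu> + 3)\<^sup>2"
proof (rule reduced_basis_3[OF det])
  fix u assume u: "lattice_of u = lattice_of u0" "\<bar>det u\<bar> = \<bar>det u0\<bar>"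
    and red: "norm (u $ 1) * norm (u $ 2) * norm (u $ 3) \<le> 2 * \<bar>det u\<bar>"
  have det_u: "det u \<noteq> 0" using u(2) det by auto
  define f where "f t = transpose u *v t" for t
  have f_sum: "f t = (\<Sum>i\<in>UNIV. t $ i *\<^sub>R u $ i)" for t
    by (simp add: f_def vec_eq_iff vector_matrix_mult_def mult.commute)
  have lin: "linear f" unfolding f_def by (rule matrix_vector_mul_linear)
  have det_f: "det (matrix f) = det u"
    unfolding f_def matrix_of_matrix_vector_mul det_transpose ..
  then have "inj f" using det_nz_iff_inj[OF lin] det_u by simp
  then have "surj f" using lin linear_injective_imp_surjective by blast
  define K' where "K' = f -` K"
  have fK: "f ` K' = K" using \<open>surj f\<close> by (simp add: K'_def)
  have coord: "\<bar>t $ i\<bar> \<le> 2 * r / \<mu>" if "t \<in> K'" for t i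
  proof -
    have "u $ i \<noteq> 0"
      using det_u det_zero_row(1)[of i u] by (auto simp: row_def vec_lambda_eta)
    then have "\<mu> \<le> norm (u $ i)" using \<mu> lattice_row u(1) by blast
    then have "\<bar>t $ i\<bar> * \<mu> \<le> \<bar>t $ i\<bar> * norm (u $ i)" by (simp add: mult_left_mono)
    also have "\<dots> \<le> 2 * norm (f t)" unfolding f_sum by (rule coordinate_bound_3[OF det_u red])
    also have "norm (f t) \<le> r" using that r(1) by (auto simp: K'_def)
    finally show ?thesis using \<open>0 < \<mu>\<close> by (simp add: field_simps)
  qed
  have convK': "convex K'" unfolding K'_def by (rule convex_linear_vimage[OF lin \<open>convex K\<close>])
  \<comment> \<open>Rounding up costs at most 1, hence
    \<open>2 * m + 1 <= 4 * r / \<mu> + 3\<close>.\<close>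
  define m where "m = nat \<lceil>2 * r / \<mu>\<rceil>"
  have m: "2 * r / \<mu> \<le> real m" "real m \<le> 2 * r / \<mu> + 1"
    using r(2) \<open>0 < \<mu>\<close> by (auto simp: m_def intro: real_nat_ceiling_ge)
  let ?v = "\<lambda>z::int^3. (\<chi> i. of_int (z $ i)) :: real^3"
  have fv: "f (?v z) = int_comb u z" for z by (simp add: f_sum int_comb_def)
  have "inj ?v" by (auto simp: inj_on_def vec_eq_iff)
  then have "inj (int_comb u)" using \<open>inj f\<close> fv by (metis (no_types, lifting) injD injI)
  moreover have "lattice_of u0 \<inter> K = int_comb u ` {z. ?v z \<in> K'}"
    unfolding u(1)[symmetric] by (auto simp: lattice_of_def K'_def fv)
  ultimately have card: "card (lattice_of u0 \<inter> K) = card {z. ?v z \<in> K'}"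
    by (simp add: card_image inj_on_subset)
  have lmK': "K' \<in> lmeasurable"
  proof (rule measurable_convex[OF convK'])
    have "K' \<subseteq> cbox (\<chi> i. - (2 * r / \<mu>)) (\<chi> i. 2 * r / \<mu>)"
      using coord by (auto simp: mem_box_cart abs_le_iff) (smt (verit))
    then show "bounded K'" using bounded_cbox bounded_subset by blast
  qed
  have "measure lebesgue K = \<bar>det u0\<bar> * measure lebesgue K'"
    using measure_linear_image[OF lin lmK'] by (simp add: fK det_f u(2))
  then have vol: "measure lebesgue K / \<bar>det u0\<bar> = measure lebesgue K'" using det by simp
  have "\<bar>real (card (lattice_of u0 \<inter> K)) - measure lebesgue K / \<bar>det u0\<bar>\<bar> \<le> real (18 * (2 * m + 1)\<^sup>2)"
    unfolding card vol
    using integer_points_in_convex[OF convK', of m] order_trans[OF coord m(1)] by simp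
  also have "\<dots> = 18 * (2 * real m + 1)\<^sup>2" by simp
  also have "\<dots> \<le> 18 * (4 * r / \<mu> + 3)\<^sup>2"
    using m(2) by (intro mult_left_mono power_mono) auto
  finally show ?thesis .
qed

section \<open>The lattice of the points \<open>(p1 + q \<alpha>, p2 + q \<beta>, q)\<close> in
  boxes\<close>

lemma prod_3: "prod f (UNIV :: 3 set) = f 1 * f 2 * f 3"
  unfolding UNIV_3 by (simp add: ac_simps)

lemma prod_Basis_vec: "(\<Prod>b\<in>Basis. x \<bullet> b) = (\<Prod>i\<in>UNIV. x $ i)" for x :: "real^'n"
  by (simp add: Basis_vec_def prod.UNION_disjoint axis_eq_axis inner_axis)

text \<open>Links the vectors used for determinants and cross products to the triples used for
  integration over sections. Lebesgue measure is determined by its values on boxes, which the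
  coordinate map preserves.\<close>

lemma measure_vec3_eq_prod:
  assumes "D \<in> sets borel"
  shows "measure lebesgue {x::real^3. (x $ 1, x $ 2, x $ 3) \<in> D} = measure lborel D"
proof -
  define f :: "real^3 \<Rightarrow> real \<times> real \<times> real" where "f = (\<lambda>x. (x $ 1, x $ 2, x $ 3))"
  have cont: "continuous_on UNIV f" unfolding f_def by (intro continuous_intros)
  have [measurable]: "f \<in> borel \<rightarrow>\<^sub>M borel" using cont by (rule borel_measurable_continuous_onI)
  have "lborel = distr lborel borel f"
  proof (rule lborel_eqI)
    fix l u :: "real \<times> real \<times> real"
    assume le: "\<And>b. b \<in> Basis \<Longrightarrow> l \<bullet> b \<le> u \<bullet> b"
    obtain l1 l2 l3 where l: "l = (l1, l2, l3)" by (cases l) auto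
    obtain u1 u2 u3 where u: "u = (u1, u2, u3)" by (cases u) auto
    have B: "(Basis :: (real \<times> real \<times> real) set) = {(1,0,0), (0,1,0), (0,0,1)}"
      by (auto simp: Basis_prod_def zero_prod_def)
    have le3: "l1 \<le> u1" "l2 \<le> u2" "l3 \<le> u3"
      using le[of "(1, 0, 0)"] le[of "(0, 1, 0)"] le[of "(0, 0, 1)"] by (simp_all add: l u B)
    have pre: "f -` box l u = box (vector [l1, l2, l3]) (vector [u1, u2, u3])"
    proof -
      have "f x \<in> box l u \<longleftrightarrow> l1 < x $ 1 \<and> x $ 1 < u1 \<and> l2 < x $ 2 \<and> x $ 2 < u2 \<and> l3 < x $ 3 \<and> x $ 3 < u3" for x
        by (auto simp: f_def l u B mem_box)
      moreover have "x \<in> box (vector [l1, l2, l3]) (vector [u1, u2, u3]) \<longleftrightarrow>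
          l1 < x $ 1 \<and> x $ 1 < u1 \<and> l2 < x $ 2 \<and> x $ 2 < u2 \<and> l3 < x $ 3 \<and> x $ 3 < u3" for x :: "real^3"
        by (auto simp: mem_box_cart forall_3)
      ultimately show ?thesis by blast
    qed
    have "emeasure (distr lborel borel f) (box l u) = emeasure lborel (box (vector [l1, l2, l3] :: real^3) (vector [u1, u2, u3]))"
      by (subst emeasure_distr) (auto simp: pre)
    also have "\<dots> = (\<Prod>b\<in>Basis. (vector [u1, u2, u3] - vector [l1, l2, l3] :: real^3) \<bullet> b)"
    proof (rule emeasure_lborel_box)
      have "\<forall>i. (vector [l1, l2, l3] :: real^3) $ i \<le> vector [u1, u2, u3] $ i"
        using le3 by (simp add: forall_3)
      then show "vector [l1, l2, l3] \<bullet> b \<le> vector [u1, u2, u3] \<bullet> b" if "b \<in> Basis" for b :: "real^3"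
        using that by (auto simp: Basis_vec_def inner_axis)
    qed
    also have "(\<Prod>b\<in>Basis. (vector [u1, u2, u3] - vector [l1, l2, l3] :: real^3) \<bullet> b) = (u1 - l1) * (u2 - l2) * (u3 - l3)"
      unfolding prod_Basis_vec prod_3 by simp
    also have "\<dots> = (\<Prod>b\<in>Basis. (u - l) \<bullet> b)" by (simp add: B l u)
    finally show "emeasure (distr lborel borel f) (box l u) = (\<Prod>b\<in>Basis. (u - l) \<bullet> b)" .
  qed simp
  then have "measure lborel D = measure (distr lborel borel f) D" by simp
  also have "\<dots> = measure lborel (f -` D)" using assms by (subst measure_distr) auto
  also have "\<dots> = measure lebesgue (f -` D)"
    using measurable_sets[OF \<open>f \<in> borel \<rightarrow>\<^sub>M borel\<close> assms] by (simp add: measure_completion)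
  also have "f -` D = {x. (x $ 1, x $ 2, x $ 3) \<in> D}" by (auto simp: f_def)
  finally show ?thesis by simp
qed

text \<open>The parameters are counted instead of the lattice points, to match
  \<open>M_set\<close>.\<close>

definition points_in :: "real \<Rightarrow> real \<Rightarrow> (real \<times> real \<times> real) set \<Rightarrow> (int \<times> int \<times> int) set" where
  "points_in \<alpha> \<beta> D = {(p1, p2, q). (of_int p1 + of_int q * \<alpha>, of_int p2 + of_int q * \<beta>, of_int q) \<in> D}"

text \<open>Dividing the coordinates by \<open>b\<close>, \<open>c\<close> and \<open>Q\<close>
  moves the box into the unit cube, and \<open>sep\<close> becomes a lower bound for the norms of
  nonzero vectors of the rescaled lattice. Its determinant \<open>1 / (b * c * Q)\<close> cancels
  against the change of volume.\<close>

lemma points_in_convex: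
  fixes D :: "(real \<times> real \<times> real) set"
  assumes "convex D" "D \<in> sets borel" and bcQ: "0 < b" "0 < c" "0 < Q"
    and D: "D \<subseteq> {-b..b} \<times> {-c..c} \<times> {-Q..Q}"
    and "0 < \<mu>"
    and sep: "\<And>p1 p2 q. (p1, p2, q) \<noteq> (0, 0, 0) \<Longrightarrow> \<mu> \<le> \<bar>of_int p1 + of_int q * \<alpha>\<bar> / b \<or>
      \<mu> \<le> \<bar>of_int p2 + of_int q * \<beta>\<bar> / c \<or> \<mu> \<le> \<bar>of_int q\<bar> / Q"
  shows "finite (points_in \<alpha> \<beta> D)"
    and "\<bar>real (card (points_in \<alpha> \<beta> D)) - measure lborel D\<bar> \<le> 18 * (8 / \<mu> + 3)\<^sup>2"
proof -
  define s :: "3 \<Rightarrow> real" where "s k = (if k = 1 then 1 / b else if k = 2 then 1 / c else 1 / Q)" for k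
  define K0 where "K0 = {x::real^3. (x $ 1, x $ 2, x $ 3) \<in> D}"
  define S :: "real^3 \<Rightarrow> real^3" where "S = (\<lambda>x. \<chi> k. s k * x $ k)"
  define K where "K = S ` K0"
  \<comment> \<open>The rows are the rescaled lattice points with parameters \<open>(1,0,0)\<close>,
    \<open>(0,1,0)\<close> and \<open>(0,0,1)\<close>.\<close>
  define u0 :: "real^3^3" where
    "u0 = vector [vector [1 / b, 0, 0], vector [0, 1 / c, 0], vector [\<alpha> / b, \<beta> / c, 1 / Q]]"
  have s [simp]: "s 1 = 1 / b" "s 2 = 1 / c" "s 3 = 1 / Q" by (simp_all add: s_def)
  have det: "det u0 = 1 / (b * c * Q)" by (simp add: u0_def det_3)
  have linS: "linear S" by (rule linearI) (auto simp: S_def vec_eq_iff algebra_simps)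
  have injS: "inj S" using bcQ by (auto simp: inj_on_def S_def vec_eq_iff forall_3)
  have "linear (\<lambda>x::real^3. (x $ 1, x $ 2, x $ 3))" by (rule linearI) auto
  then have "convex ((\<lambda>x::real^3. (x $ 1, x $ 2, x $ 3)) -` D)"
    using \<open>convex D\<close> by (rule convex_linear_vimage)
  then have convK0: "convex K0" by (simp add: K0_def vimage_def)
  have convK: "convex K" unfolding K_def by (rule convex_linear_image[OF linS convK0])
  have "K0 \<subseteq> cbox (vector [-b, -c, -Q]) (vector [b, c, Q])"
    using D by (auto simp: K0_def mem_box_cart forall_3)
  then have "bounded K0" using bounded_cbox bounded_subset by blast
  then have "K0 \<in> lmeasurable" using convK0 by (intro measurable_convex)
  then have "measure lebesgue K = \<bar>prod s UNIV\<bar> * measure lebesgue K0"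
    unfolding K_def S_def using measure_stretch[of K0 s] by blast
  also have "\<bar>prod s UNIV\<bar> = det u0" using bcQ by (simp add: prod_3 det)
  also have "measure lebesgue K0 = measure lborel D"
    unfolding K0_def by (rule measure_vec3_eq_prod) fact
  finally have vol: "measure lebesgue K / \<bar>det u0\<bar> = measure lborel D" using bcQ by (simp add: det)
  \<comment> \<open>The cube with coordinates at most 1 in absolute value has radius
    \<open>sqrt 3\<close>; the radius 2 gives the 8 in the error term.\<close>
  have ball: "K \<subseteq> cball 0 2"
  proof
    fix y assume "y \<in> K"
    then obtain x where x: "x \<in> K0" "y = S x" by (auto simp: K_def)
    have "\<bar>x $ 1\<bar> \<le> b" "\<bar>x $ 2\<bar> \<le> c" "\<bar>x $ 3\<bar> \<le> Q"
      using x D by (auto simp: K0_def abs_le_iff minus_le_iff)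
    then have "\<bar>y $ 1\<bar> \<le> 1" "\<bar>y $ 2\<bar> \<le> 1" "\<bar>y $ 3\<bar> \<le> 1" using bcQ by (auto simp: x S_def)
    then have "(y $ 1)\<^sup>2 \<le> 1" "(y $ 2)\<^sup>2 \<le> 1" "(y $ 3)\<^sup>2 \<le> 1" by (simp_all add: abs_square_le_1)
    moreover have "(norm y)\<^sup>2 = (y $ 1)\<^sup>2 + (y $ 2)\<^sup>2 + (y $ 3)\<^sup>2"
      unfolding power2_norm_eq_inner by (simp add: inner_vec_def sum_3 power2_eq_square)
    ultimately have "(norm y)\<^sup>2 \<le> 2\<^sup>2" by simp
    then have "norm y \<le> 2" by (rule power2_le_imp_le) simp
    then show "y \<in> cball 0 2" by simp
  qed
  define g :: "int \<times> int \<times> int \<Rightarrow> real^3" where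
    "g = (\<lambda>(p1, p2, q). vector [of_int p1 + of_int q * \<alpha>, of_int p2 + of_int q * \<beta>, of_int q])"
  have comb: "int_comb u0 z = S (g (z $ 1, z $ 2, z $ 3))" for z
    by (simp add: int_comb_def sum_3 u0_def S_def g_def vec_eq_iff forall_3 add_divide_distrib)
  have range: "lattice_of u0 = range (S \<circ> g)"
  proof -
    have "int_comb u0 z \<in> range (S \<circ> g)" for z by (simp add: comb)
    moreover have "(S \<circ> g) p \<in> range (int_comb u0)" for p
    proof (cases p)
      case (fields p1 p2 q)
      then have "(S \<circ> g) p = int_comb u0 (vector [p1, p2, q])" by (simp add: comb)
      then show ?thesis by (simp only: rangeI)
    qed
    ultimately show ?thesis unfolding lattice_of_def by blast
  qed
  have injg: "inj g" by (auto simp: inj_on_def g_def vec_eq_iff forall_3)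
  have inj: "inj (S \<circ> g)" using injS injg by (rule inj_compose)
  have img: "lattice_of u0 \<inter> K = (S \<circ> g) ` points_in \<alpha> \<beta> D"
  proof -
    have "points_in \<alpha> \<beta> D = g -` K0" by (auto simp: points_in_def g_def K0_def)
    moreover have "S (g p) \<in> K \<longleftrightarrow> g p \<in> K0" for p
      unfolding K_def using injS by (simp add: inj_image_mem_iff)
    ultimately show ?thesis by (auto simp: range)
  qed
  have card: "card (lattice_of u0 \<inter> K) = card (points_in \<alpha> \<beta> D)"
    unfolding img by (rule card_image) (rule inj_on_subset[OF inj], simp)
  have "det u0 \<noteq> 0" using bcQ by (simp add: det)
  from finite_lattice_cball[OF this, of 2] have "finite (lattice_of u0 \<inter> K)"
    by (rule finite_subset[rotated]) (use ball in auto)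
  then show "finite (points_in \<alpha> \<beta> D)"
    unfolding img by (rule finite_imageD) (rule inj_on_subset[OF inj], simp)
  have "\<bar>real (card (lattice_of u0 \<inter> K)) - measure lebesgue K / \<bar>det u0\<bar>\<bar> \<le> 18 * (4 * 2 / \<mu> + 3)\<^sup>2"
  proof (rule lattice_points_in_convex)
    fix x assume x: "x \<in> lattice_of u0" "x \<noteq> 0"
    then obtain p1 p2 q where p: "x = S (g (p1, p2, q))" by (auto simp: range)
    have x123: "\<bar>x $ 1\<bar> = \<bar>of_int p1 + of_int q * \<alpha>\<bar> / b" "\<bar>x $ 2\<bar> = \<bar>of_int p2 + of_int q * \<beta>\<bar> / c"
      "\<bar>x $ 3\<bar> = \<bar>of_int q\<bar> / Q"
      using bcQ by (simp_all add: p S_def g_def abs_mult)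
    have "(p1, p2, q) \<noteq> (0, 0, 0)" using x by (auto simp: p S_def g_def vec_eq_iff forall_3)
    from sep[OF this] show "\<mu> \<le> norm x"
      using component_le_norm_cart[of x 1] component_le_norm_cart[of x 2] component_le_norm_cart[of x 3]
      unfolding x123 by linarith
  qed (use \<open>det u0 \<noteq> 0\<close> \<open>0 < \<mu>\<close> convK ball in auto)
  then show "\<bar>real (card (points_in \<alpha> \<beta> D)) - measure lborel D\<bar> \<le> 18 * (8 / \<mu> + 3)\<^sup>2"
    by (simp add: card vol)
qed

section \<open>The region below a hyperbola\<close>

text \<open>Half-open in \<open>x\<close>, so that consecutive slabs neither overlap nor leave a
  gap.\<close>

definition hyp_slab :: "real \<Rightarrow> real \<Rightarrow> real \<Rightarrow> real \<Rightarrow> real \<Rightarrow> (real \<times> real \<times> real) set" where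
  "hyp_slab \<epsilon> T Q a b = {(x, y, z). a < x \<and> x \<le> b \<and> 0 < y \<and> y \<le> T \<and> x * y < \<epsilon> \<and> 0 < z \<and> z \<le> Q}"

lemma fst_snd_borel [measurable]:
  "(fst :: real \<times> real \<times> real \<Rightarrow> real) \<in> borel_measurable borel"
  "(\<lambda>p::real \<times> real \<times> real. fst (snd p)) \<in> borel_measurable borel"
  "(\<lambda>p::real \<times> real \<times> real. snd (snd p)) \<in> borel_measurable borel"
  by (intro borel_measurable_continuous_onI continuous_intros)+

lemma hyp_slab_borel: "hyp_slab \<epsilon> T Q a b \<in> sets borel"
proof -
  have "hyp_slab \<epsilon> T Q a b = {p. a < fst p \<and> fst p \<le> b \<and> 0 < fst (snd p) \<and> fst (snd p) \<le> T \<and>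
      fst p * fst (snd p) < \<epsilon> \<and> 0 < snd (snd p) \<and> snd (snd p) \<le> Q}"
    by (auto simp: hyp_slab_def)
  also have "\<dots> \<in> sets borel" by measurable
  finally show ?thesis .
qed

text \<open>By the inequality of arithmetic and geometric means, the mixed term
  \<open>x * y' + x' * y\<close> is at least \<open>2 * \<epsilon>\<close>; the product of the
  convex combinations is then at least \<open>(u + v)\<^sup>2 * \<epsilon>\<close>.\<close>

lemma convex_above_hyperbola:
  assumes "0 < (\<epsilon>::real)"
  shows "convex {(x, y, z). 0 < x \<and> 0 < y \<and> \<epsilon> \<le> x * y}" (is "convex ?S")
proof -
  have "\<epsilon> \<le> (u * x + v * x') * (u * y + v * y')"
    if pos: "0 < x" "0 < y" "0 < x'" "0 < y'" and xy: "\<epsilon> \<le> x * y" "\<epsilon> \<le> x' * y'"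
      and uv: "0 \<le> u" "0 \<le> v" "u + v = 1" for x y x' y' u v :: real
  proof -
    have "(2 * \<epsilon>)\<^sup>2 \<le> 4 * ((x * y) * (x' * y'))"
      using mult_mono[OF xy] assms pos by (simp add: power2_eq_square)
    also have "\<dots> \<le> (x * y' + x' * y)\<^sup>2"
      using zero_le_power2[of "x * y' - x' * y"] by (simp add: power2_eq_square algebra_simps)
    finally have "2 * \<epsilon> \<le> x * y' + x' * y"
      by (rule power2_le_imp_le) (use pos in simp)
    then have "u * v * (2 * \<epsilon>) + u\<^sup>2 * \<epsilon> + v\<^sup>2 * \<epsilon> \<le> u * v * (x * y' + x' * y) + u\<^sup>2 * (x * y) + v\<^sup>2 * (x' * y')"
      using uv xy by (intro add_mono mult_left_mono) auto
    moreover have "u * v * (2 * \<epsilon>) + u\<^sup>2 * \<epsilon> + v\<^sup>2 * \<epsilon> = (u + v)\<^sup>2 * \<epsilon>"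
      by (simp add: power2_eq_square algebra_simps)
    ultimately show ?thesis using uv(3) by (simp add: power2_eq_square algebra_simps)
  qed
  moreover have "0 < u * x + v * x'" if "0 < x" "0 < x'" "0 \<le> u" "0 \<le> v" "u + v = 1" for x x' u v :: real
    using that by (smt (verit) mult_nonneg_nonneg mult_pos_pos)
  ultimately show ?thesis by (intro convexI) auto
qed

text \<open>The slab is a box of height \<open>c\<close> minus the convex part above the hyperbola,
  so the error 18 doubles to 36. The alternative for \<open>c\<close> ensures that the box is high
  enough: beyond \<open>x = a\<close> the hyperbola stays below
  \<open>\<epsilon> / a\<close>.\<close>

lemma points_in_hyp_slab:
  assumes pos: "0 < \<epsilon>" "0 \<le> a" "a < b" "0 < c" "0 < Q"
    and c: "c \<le> T" "c = T \<or> \<epsilon> \<le> a * c"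
    and "0 < \<mu>"
    and sep: "\<And>p1 p2 q. (p1, p2, q) \<noteq> (0, 0, 0) \<Longrightarrow> \<mu> \<le> \<bar>of_int p1 + of_int q * \<alpha>\<bar> / b \<or>
      \<mu> \<le> \<bar>of_int p2 + of_int q * \<beta>\<bar> / c \<or> \<mu> \<le> \<bar>of_int q\<bar> / Q"
  shows "finite (points_in \<alpha> \<beta> (hyp_slab \<epsilon> T Q a b))"
    and "\<bar>real (card (points_in \<alpha> \<beta> (hyp_slab \<epsilon> T Q a b))) - measure lborel (hyp_slab \<epsilon> T Q a b)\<bar>
      \<le> 36 * (8 / \<mu> + 3)\<^sup>2"
proof -
  let ?H = "hyp_slab \<epsilon> T Q a b"
  define B where "B = {a<..b} \<times> {0<..c} \<times> {0<..Q}"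
  define C where "C = B \<inter> {(x, y, z). 0 < x \<and> 0 < y \<and> \<epsilon> \<le> x * y}"
  have convB: "convex B" unfolding B_def by (intro convex_Times) simp_all
  have convC: "convex C" unfolding C_def using convB convex_above_hyperbola[OF pos(1)] by (rule convex_Int)
  have "B = {p. a < fst p \<and> fst p \<le> b \<and> 0 < fst (snd p) \<and> fst (snd p) \<le> c \<and> 0 < snd (snd p) \<and> snd (snd p) \<le> Q}"
    by (auto simp: B_def)
  also have "\<dots> \<in> sets borel" by measurable
  finally have Bm: "B \<in> sets borel" .
  have "C = B \<inter> {p. 0 < fst p \<and> 0 < fst (snd p) \<and> \<epsilon> \<le> fst p * fst (snd p)}"
    by (auto simp: C_def)
  also have "\<dots> \<in> sets borel" by (intro sets.Int Bm) measurable
  finally have Cm: "C \<in> sets borel" .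
  have H: "?H = B - C"
  proof -
    have "y \<le> c" if "a < x" "0 < y" "y \<le> T" "x * y < \<epsilon>" for x y
    proof (cases "c = T")
      case False
      then have "\<epsilon> \<le> a * c" using c by simp
      with that have "x * y < x * c" using \<open>0 < c\<close> by (smt (verit) mult_strict_right_mono)
      then show ?thesis using that pos by simp
    qed (use that in simp)
    then show ?thesis using c(1) pos by (fastforce simp: hyp_slab_def B_def C_def)
  qed
  have CB: "C \<subseteq> B" by (auto simp: C_def)
  have Bbox: "B \<subseteq> {-b..b} \<times> {-c..c} \<times> {-Q..Q}" using pos by (auto simp: B_def)
  have "0 < b" using pos by simp
  note count = points_in_convex[OF _ _ \<open>0 < b\<close> \<open>0 < c\<close> \<open>0 < Q\<close> _ \<open>0 < \<mu>\<close> sep]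
  note countB = count[OF convB Bm Bbox] and countC = count[OF convC Cm order_trans[OF CB Bbox]]
  have pts: "points_in \<alpha> \<beta> ?H = points_in \<alpha> \<beta> B - points_in \<alpha> \<beta> C"
    by (auto simp: H points_in_def)
  then show "finite (points_in \<alpha> \<beta> ?H)" using countB(1) by simp
  have sub: "points_in \<alpha> \<beta> C \<subseteq> points_in \<alpha> \<beta> B" using CB by (auto simp: points_in_def)
  then have "card (points_in \<alpha> \<beta> C) \<le> card (points_in \<alpha> \<beta> B)" using countB(1) by (intro card_mono)
  then have card: "real (card (points_in \<alpha> \<beta> ?H)) = real (card (points_in \<alpha> \<beta> B)) - real (card (points_in \<alpha> \<beta> C))"
    unfolding pts using sub countC(1) by (simp add: card_Diff_subset of_nat_diff)
  have "emeasure lborel B < \<infinity>"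
  proof (rule emeasure_bounded_finite)
    show "bounded B" unfolding B_def by (intro bounded_Times) simp_all
  qed
  then have "measure lborel ?H = measure lborel B - measure lborel C"
    unfolding H using Bm Cm CB by (intro measure_Diff) auto
  with card countB(2) countC(2) show "\<bar>real (card (points_in \<alpha> \<beta> ?H)) - measure lborel ?H\<bar> \<le> 36 * (8 / \<mu> + 3)\<^sup>2"
    by linarith
qed

text \<open>Integrate over \<open>x\<close>: the section is a product of a set of length
  \<open>g x\<close> with an interval of length \<open>Q\<close>, and \<open>F\<close> is an
  antiderivative of \<open>g\<close>.\<close>

lemma measure_hyp_slab:
  assumes "a \<le> b" "0 < Q"
    and g: "\<And>x. a < x \<Longrightarrow> x \<le> b \<Longrightarrow> emeasure lborel {y. 0 < y \<and> y \<le> T \<and> x * y < \<epsilon>} = ennreal (g x)"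
    and [measurable]: "g \<in> borel_measurable borel"
    and F: "\<And>x. x \<in> {a..b} \<Longrightarrow> DERIV F x :> g x" and g_nonneg: "\<And>x. x \<in> {a..b} \<Longrightarrow> 0 \<le> g x"
  shows "measure lborel (hyp_slab \<epsilon> T Q a b) = Q * (F b - F a)"
proof -
  let ?H = "hyp_slab \<epsilon> T Q a b"
  have Hm: "?H \<in> sets (lborel \<Otimes>\<^sub>M (lborel \<Otimes>\<^sub>M lborel))"
    by (simp only: lborel_prod sets_lborel hyp_slab_borel)
  have "emeasure lborel ?H = emeasure (lborel \<Otimes>\<^sub>M (lborel \<Otimes>\<^sub>M lborel)) ?H" by (simp only: lborel_prod)
  also have "\<dots> = (\<integral>\<^sup>+x. emeasure (lborel \<Otimes>\<^sub>M lborel) (Pair x -` ?H) \<partial>lborel)"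
    using Hm unfolding lborel_prod by (intro lborel.emeasure_pair_measure_alt[of _ lborel, unfolded lborel_prod])
  also have "\<dots> = (\<integral>\<^sup>+x. ennreal (Q * g x) * indicator {a..b} x \<partial>lborel)"
  proof (rule nn_integral_cong_AE)
    \<comment> \<open>The slab omits \<open>x = a\<close>, while the integral runs over the closed
      interval.\<close>
    have "AE x in lborel. x \<noteq> a" by (rule AE_lborel_singleton)
    then show "AE x in lborel. emeasure (lborel \<Otimes>\<^sub>M lborel) (Pair x -` ?H) = ennreal (Q * g x) * indicator {a..b} x"
    proof eventually_elim
      case (elim x)
      show ?case
      proof (cases "a < x \<and> x \<le> b")
        case True
        have "Pair x -` ?H = {y. 0 < y \<and> y \<le> T \<and> x * y < \<epsilon>} \<times> {0<..Q}"
          using True by (auto simp: hyp_slab_def)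
        then have "emeasure (lborel \<Otimes>\<^sub>M lborel) (Pair x -` ?H) =
            emeasure lborel {y. 0 < y \<and> y \<le> T \<and> x * y < \<epsilon>} * emeasure lborel {0<..Q}"
          by (simp only:) (rule lborel.emeasure_pair_measure_Times, auto)
        also have "\<dots> = ennreal (g x) * ennreal Q" using g True \<open>0 < Q\<close> by simp
        also have "\<dots> = ennreal (Q * g x)"
          using g_nonneg[of x] True \<open>0 < Q\<close> by (simp add: ennreal_mult' mult.commute)
        finally show ?thesis using True by simp
      next
        case False
        then have "Pair x -` ?H = {}" "x \<notin> {a..b}" using elim by (auto simp: hyp_slab_def)
        then show ?thesis by simp
      qed
    qed
  qed
  also have "\<dots> = ennreal (Q * F b - Q * F a)"
    using assms by (intro nn_integral_FTC_Icc) (auto intro!: derivative_eq_intros DERIV_subset[OF F])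
  finally have "measure lborel ?H = enn2real (ennreal (Q * F b - Q * F a))" by (simp add: measure_def)
  moreover have "F a \<le> F b"
    using DERIV_nonneg_imp_nondecreasing[OF \<open>a \<le> b\<close>] F g_nonneg by (metis atLeastAtMost_iff)
  ultimately show ?thesis using \<open>0 < Q\<close> by (simp add: right_diff_distrib)
qed

text \<open>From \<open>\<epsilon> / T\<close> on, the hyperbola lies below height \<open>T\<close>,
  so the section in \<open>y\<close> has length \<open>\<epsilon> / x\<close>.\<close>

lemma measure_hyp_slab_log:
  assumes "0 < \<epsilon>" "0 < T" "0 < Q" "\<epsilon> / T \<le> a" "a \<le> b"
  shows "measure lborel (hyp_slab \<epsilon> T Q a b) = \<epsilon> * Q * ln (b / a)"
proof -
  have "0 < a" using assms by (smt (verit) divide_pos_pos)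
  have "measure lborel (hyp_slab \<epsilon> T Q a b) = Q * (\<epsilon> * ln b - \<epsilon> * ln a)"
  proof (rule measure_hyp_slab[where g = "\<lambda>x. \<epsilon> / x"])
    fix x assume x: "a < x" "x \<le> b"
    then have "T * a \<le> T * x" using assms by simp
    moreover have "\<epsilon> \<le> T * a" using assms by (simp add: field_simps)
    ultimately have "\<epsilon> / x \<le> T" using x \<open>0 < a\<close> by (simp add: field_simps)
    moreover have "x * y < \<epsilon> \<longleftrightarrow> y < \<epsilon> / x" for y using x \<open>0 < a\<close> by (simp add: field_simps)
    ultimately have "{y. 0 < y \<and> y \<le> T \<and> x * y < \<epsilon>} = {0<..<\<epsilon> / x}"
      by (intro set_eqI) (simp only: mem_Collect_eq greaterThanLessThan_iff, linarith)
    then show "emeasure lborel {y. 0 < y \<and> y \<le> T \<and> x * y < \<epsilon>} = ennreal (\<epsilon> / x)"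
      using x \<open>0 < a\<close> assms by simp
  next
    fix x assume "x \<in> {a..b}"
    then show "DERIV (\<lambda>x. \<epsilon> * ln x) x :> \<epsilon> / x" using \<open>0 < a\<close> by (auto intro!: derivative_eq_intros)
  qed (use assms \<open>0 < a\<close> in auto)
  then show ?thesis using assms \<open>0 < a\<close> by (simp add: ln_div algebra_simps)
qed

text \<open>Up to \<open>\<epsilon> / T\<close> the hyperbola lies at or above height
  \<open>T\<close>, so the section in \<open>y\<close> has length \<open>T\<close>.\<close>

lemma measure_hyp_slab_first:
  assumes "0 < \<epsilon>" "0 < T" "0 < Q"
  shows "measure lborel (hyp_slab \<epsilon> T Q 0 (\<epsilon> / T)) = \<epsilon> * Q"
proof -
  have "measure lborel (hyp_slab \<epsilon> T Q 0 (\<epsilon> / T)) = Q * (T * (\<epsilon> / T) - T * 0)"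
  proof (rule measure_hyp_slab[where g = "\<lambda>_. T"])
    fix x assume x: "0 < x" "x \<le> \<epsilon> / T"
    show "emeasure lborel {y. 0 < y \<and> y \<le> T \<and> x * y < \<epsilon>} = ennreal T"
    \<comment> \<open>At the right end the strict inequality removes only the endpoint
      \<open>y = T\<close>.\<close>
    proof (cases "x = \<epsilon> / T")
      case True
      then have "x * T = \<epsilon>" using assms by simp
      then have "x * y < \<epsilon> \<longleftrightarrow> y < T" for y using mult_less_cancel_left_pos[of x y T] x(1) by simp
      then have "{y. 0 < y \<and> y \<le> T \<and> x * y < \<epsilon>} = {0<..<T}"
        by (intro set_eqI) (simp only: mem_Collect_eq greaterThanLessThan_iff, linarith)
      then show ?thesis using assms by simp
    next
      case False
      have "x * y < \<epsilon>" if "y \<le> T" for y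
      proof -
        have "x * y \<le> x * T" using x that by simp
        also have "\<dots> < \<epsilon>" using x False assms by (simp add: field_simps)
        finally show ?thesis .
      qed
      then have "{y. 0 < y \<and> y \<le> T \<and> x * y < \<epsilon>} = {0<..T}" by auto
      then show ?thesis using assms by simp
    qed
  next
    show "DERIV ((*) T) x :> T" for x by (auto intro!: derivative_eq_intros)
  qed (use assms in auto)
  then show ?thesis using assms by simp
qed

text \<open>If all three rescaled coordinates were below \<open>\<mu>\<close>, then for nonzero
  \<open>q\<close> the product of the coordinates would be at most
  \<open>\<mu> ^ 3 * Q * (3 * \<epsilon>) <= 3 / 8 * \<delta>\<close>, against \<open>adm\<close>.
  The factor 2 in \<open>\<mu>\<close> absorbs the 3, and \<open>1 + T\<close> handles
  \<open>q = 0\<close>.\<close>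

lemma rescaled_norm_lower_bound:
  fixes p1 p2 q :: int and Q T \<epsilon> \<delta> \<rho> b c \<alpha> \<beta> :: real
  assumes adm: "\<And>p1 p2 q. q \<noteq> 0 \<Longrightarrow> \<bar>of_int q\<bar> \<le> Q \<Longrightarrow>
      \<delta> \<le> \<bar>of_int q\<bar> * \<bar>of_int p1 + of_int q * \<alpha>\<bar> * \<bar>of_int p2 + of_int q * \<beta>\<bar>"
    and pos: "0 < \<epsilon>" "0 < T" "0 < Q" "0 < \<delta>" "\<delta> \<le> \<epsilon> * Q"
    and bc: "0 < b" "b \<le> T" "0 < c" "c \<le> T" "b * c \<le> 3 * \<epsilon>"
    and \<rho>: "0 < \<rho>" "\<rho> ^ 3 = \<epsilon> * Q / \<delta>"
    and nz: "(p1, p2, q) \<noteq> (0, 0, 0)"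
  defines "\<mu> \<equiv> 1 / (2 * \<rho> * (1 + T))"
  shows "\<mu> \<le> \<bar>of_int p1 + of_int q * \<alpha>\<bar> / b \<or> \<mu> \<le> \<bar>of_int p2 + of_int q * \<beta>\<bar> / c \<or> \<mu> \<le> \<bar>of_int q\<bar> / Q"
proof (rule ccontr)
  let ?x = "\<bar>of_int p1 + of_int q * \<alpha>\<bar>" and ?y = "\<bar>of_int p2 + of_int q * \<beta>\<bar>" and ?z = "\<bar>of_int q\<bar> :: real"
  assume "\<not> ?thesis"
  then have lt: "?x < \<mu> * b" "?y < \<mu> * c" "?z < \<mu> * Q"
    using bc pos by (auto simp: not_le field_simps)
  have "1 ^ 3 \<le> \<rho> ^ 3" using pos by (simp add: \<rho>)
  then have \<rho>1: "1 \<le> \<rho>" using power_mono_iff[of 1 \<rho> 3] \<rho>(1) by simp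
  have \<mu>pos: "0 < \<mu>" using \<rho>1 pos by (simp add: \<mu>_def)
  have "1 * T \<le> (2 * \<rho>) * (1 + T)" "1 * 1 \<le> (2 * \<rho>) * (1 + T)"
    "(2 * \<rho>) * 1 \<le> (2 * \<rho>) * (1 + T)"
    using \<rho>1 pos by (intro mult_mono; simp)+
  \<comment> \<open>The first bound excludes nonzero integers \<open>p1\<close>, \<open>p2\<close>
    when \<open>q = 0\<close>, the second gives \<open>\<bar>q\<bar> <= Q\<close> so that
    \<open>adm\<close> applies, and the third enters the product estimate.\<close>
  then have \<mu>le: "\<mu> * T \<le> 1" "\<mu> \<le> 1" "\<mu> \<le> 1 / (2 * \<rho>)"
    using \<rho>1 pos by (auto simp: \<mu>_def divide_simps mult_ac)
  show False
  proof (cases "q = 0")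
    case True
    have "\<mu> * b \<le> 1" "\<mu> * c \<le> 1"
      using bc \<mu>pos \<mu>le(1) by (auto intro: order_trans[OF mult_left_mono])
    then have "\<bar>of_int p1 :: real\<bar> < 1" "\<bar>of_int p2 :: real\<bar> < 1" using lt True by auto
    then have "p1 = 0" "p2 = 0" by linarith+
    then show False using nz True by simp
  next
    case False
    have "\<mu> * Q \<le> 1 * Q" using \<mu>le(2) pos by (intro mult_right_mono) auto
    then have zQ: "?z \<le> Q" using lt(3) by simp
    have "\<delta> \<le> ?z * ?x * ?y" using adm[OF False zQ, of p1 p2] by simp
    also have "\<dots> \<le> (\<mu> * Q) * (\<mu> * b) * (\<mu> * c)"
      using lt by (intro mult_mono) auto
    also have "\<dots> = \<mu> ^ 3 * Q * (b * c)" by (simp add: power3_eq_cube)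
    also have "\<dots> \<le> \<mu> ^ 3 * Q * (3 * \<epsilon>)" using bc pos \<mu>pos by (intro mult_left_mono) auto
    also have "\<dots> \<le> (1 / (2 * \<rho>)) ^ 3 * Q * (3 * \<epsilon>)"
      using \<mu>le(3) \<mu>pos pos by (intro mult_right_mono power_mono) auto
    also have "\<dots> = 3 * (\<epsilon> * Q) / (8 * (\<epsilon> * Q / \<delta>))"
      by (simp add: power_divide power_mult_distrib \<rho>(2))
    also have "\<dots> = 3 / 8 * \<delta>" using pos by (simp add: field_simps)
    finally show False using \<open>0 < \<delta>\<close> by simp
  qed
qed

text \<open>The slab up to \<open>\<epsilon> / T\<close> contributes the main term
  \<open>\<epsilon> * Q\<close>. The rest is cut at the geometric progression \<open>s\<close>,
  where each of \<open>n\<close> slabs contributes \<open>\<epsilon> * Q * (L / n)\<close>. The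
  errors of the \<open>n + 1\<close> slabs add up.\<close>

lemma points_in_quadrant:
  assumes adm: "\<And>p1 p2 q. q \<noteq> 0 \<Longrightarrow> \<bar>of_int q\<bar> \<le> Q \<Longrightarrow>
      \<delta> \<le> \<bar>of_int q\<bar> * \<bar>of_int p1 + of_int q * \<alpha>\<bar> * \<bar>of_int p2 + of_int q * \<beta>\<bar>"
    and pos: "0 < \<epsilon>" "0 < T" "0 < Q" "0 < \<delta>" "\<delta> \<le> \<epsilon> * Q"
    and \<rho>: "0 < \<rho>" "\<rho> ^ 3 = \<epsilon> * Q / \<delta>"
    and L: "L = ln (T\<^sup>2 / \<epsilon>)" "2 \<le> L"
  shows "finite (points_in \<alpha> \<beta> (hyp_slab \<epsilon> T Q 0 T))"
    and "\<bar>real (card (points_in \<alpha> \<beta> (hyp_slab \<epsilon> T Q 0 T))) - \<epsilon> * Q * (L + 1)\<bar>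
      \<le> 25992 * L * (1 + T)\<^sup>2 * \<rho>\<^sup>2"
proof -
  let ?P = "\<lambda>a b. points_in \<alpha> \<beta> (hyp_slab \<epsilon> T Q a b)"
  define \<mu> where "\<mu> = 1 / (2 * \<rho> * (1 + T))"
  define E where "E = 36 * (8 / \<mu> + 3)\<^sup>2"
  define n where "n = nat \<lceil>L\<rceil>"
  have n: "L \<le> real n" "real n \<le> L + 1" "0 < n" using L(2) by (auto simp: n_def intro: real_nat_ceiling_ge)
  define s where "s j = \<epsilon> / T * exp (L * real j / real n)" for j
  have \<mu>pos: "0 < \<mu>" using \<rho> pos by (simp add: \<mu>_def)
  note sep = rescaled_norm_lower_bound[OF adm pos _ _ _ _ _ \<rho>, folded \<mu>_def]
  note slab = points_in_hyp_slab[OF pos(1) _ _ _ pos(3) _ _ \<mu>pos sep]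
  have s0: "s 0 = \<epsilon> / T" by (simp add: s_def)
  have expL: "exp L = T\<^sup>2 / \<epsilon>" using pos by (simp add: L(1))
  have sn: "s n = T" using n(3) pos by (simp add: s_def expL power2_eq_square)
  have s_mono: "s i < s j" if "i < j" for i j
  proof -
    have "L * real i / real n < L * real j / real n"
      using that n(3) L(2) by (intro divide_strict_right_mono mult_strict_left_mono) auto
    then show ?thesis unfolding s_def using pos by (intro mult_strict_left_mono) auto
  qed
  have s_le: "s i \<le> s j" if "i \<le> j" for i j using that s_mono[of i j] by (cases "i = j") auto
  have s_pos: "0 < s j" for j using pos by (simp add: s_def)
  have s_Suc: "s (Suc j) = s j * exp (L / real n)" for j
    by (simp add: s_def distrib_left add_divide_distrib exp_add)
  \<comment> \<open>The ratio of consecutive cuts is at most \<open>exp 1\<close> because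
    \<open>L <= n\<close>; this is the 3 in \<open>b * c <= 3 * \<epsilon>\<close>.\<close>
  have exp3: "exp (L / real n) \<le> 3"
    using n exp_le by (smt (verit, best) divide_le_eq_1 exp_le_cancel_iff of_nat_0_less_iff)
  have partial: "finite (?P 0 (s k)) \<and> \<bar>real (card (?P 0 (s k))) - \<epsilon> * Q * (1 + real k * (L / real n))\<bar> \<le> (1 + real k) * E"
    if "k \<le> n" for k
    using that
  proof (induction k)
    case 0
    have "\<epsilon> / T \<le> T" using s_le[of 0 n] s0 sn by simp
    \<comment> \<open>The first slab uses the full height \<open>T\<close>; its box has
      \<open>b * c = \<epsilon>\<close>.\<close>
    then show ?case
      using slab[of 0 "s 0" T] s_pos[of 0] pos measure_hyp_slab_first[of \<epsilon> T Q]
      by (simp add: s0 E_def)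
  next
    case (Suc k)
    have split: "?P 0 (s (Suc k)) = ?P 0 (s k) \<union> ?P (s k) (s (Suc k))"
      using s_mono[of k "Suc k"] s_pos[of k] by (auto simp: points_in_def hyp_slab_def)
    have disj: "?P 0 (s k) \<inter> ?P (s k) (s (Suc k)) = {}"
      by (auto simp: points_in_def hyp_slab_def)
    \<comment> \<open>The height of the hyperbola at the left end of the slab.\<close>
    define c where "c = \<epsilon> / s k"
    have c: "0 < c" "s k * c = \<epsilon>" using pos s_pos[of k] by (simp_all add: c_def)
    have "\<epsilon> = T * s 0" using pos by (simp add: s0)
    also have "\<dots> \<le> T * s k" using s_le[of 0 k] pos by simp
    finally have cT: "c \<le> T" using s_pos[of k] by (simp add: c_def field_simps)
    have "s (Suc k) \<le> T" using s_le[OF Suc.prems] sn by simp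
    moreover have "s (Suc k) * c \<le> 3 * \<epsilon>"
      using exp3 pos s_pos[of k] by (simp add: s_Suc c_def)
    ultimately have new: "finite (?P (s k) (s (Suc k)))"
      "\<bar>real (card (?P (s k) (s (Suc k)))) - measure lborel (hyp_slab \<epsilon> T Q (s k) (s (Suc k)))\<bar> \<le> E"
      using slab[of "s k" "s (Suc k)" c] s_pos[of k] s_pos[of "Suc k"] s_mono[of k "Suc k"] c cT
      by (simp_all add: E_def)
    have "s (Suc k) / s k = exp (L / real n)" using s_pos[of k] by (simp add: s_Suc)
    then have "measure lborel (hyp_slab \<epsilon> T Q (s k) (s (Suc k))) = \<epsilon> * Q * (L / real n)"
      using pos s_le[of 0 k] s_le[of k "Suc k"] s0 by (subst measure_hyp_slab_log) auto
    moreover have "real (card (?P 0 (s (Suc k)))) = real (card (?P 0 (s k))) + real (card (?P (s k) (s (Suc k))))"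
      unfolding split using Suc new disj by (subst card_Un_disjoint) auto
    moreover have "\<epsilon> * Q * (1 + real (Suc k) * (L / real n)) = \<epsilon> * Q * (1 + real k * (L / real n)) + \<epsilon> * Q * (L / real n)"
      by (simp add: algebra_simps add_divide_distrib)
    moreover have "(1 + real (Suc k)) * E = (1 + real k) * E + E" by (simp add: algebra_simps)
    moreover have "finite (?P 0 (s (Suc k)))" unfolding split using Suc new by simp
    ultimately show ?case using Suc new by auto
  qed
  from partial[of n] show "finite (?P 0 T)" by (simp add: sn)
  have "\<bar>real (card (?P 0 T)) - \<epsilon> * Q * (L + 1)\<bar> \<le> (1 + real n) * E"
    using partial[of n] n(3) by (simp add: sn add.commute)
  \<comment> \<open>The number of slabs is at most \<open>L + 2 <= 2 * L\<close>, as
    \<open>2 <= L\<close>. Since \<open>1 <= \<rho> * (1 + T)\<close>, the summands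
    \<open>8 / \<mu> = 16 * \<rho> * (1 + T)\<close> and 3 combine to the factor 19.\<close>
  also have "\<dots> \<le> (2 * L) * (36 * (19 * \<rho> * (1 + T))\<^sup>2)"
  proof (rule mult_mono)
    have "1 ^ 3 \<le> \<rho> ^ 3" using pos by (simp add: \<rho>)
    then have "1 \<le> \<rho>" using power_mono_iff[of 1 \<rho> 3] \<rho>(1) by simp
    then have "1 * 1 \<le> \<rho> * (1 + T)" using pos by (intro mult_mono) auto
    then have "8 / \<mu> + 3 \<le> 19 * \<rho> * (1 + T)" by (simp add: \<mu>_def)
    then show "E \<le> 36 * (19 * \<rho> * (1 + T))\<^sup>2"
      unfolding E_def using \<mu>pos by (intro mult_left_mono power_mono) auto
  qed (use n L E_def in auto)
  also have "\<dots> = 25992 * L * (1 + T)\<^sup>2 * \<rho>\<^sup>2" by (simp add: power_mult_distrib)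
  finally show "\<bar>real (card (?P 0 T)) - \<epsilon> * Q * (L + 1)\<bar> \<le> 25992 * L * (1 + T)\<^sup>2 * \<rho>\<^sup>2" .
qed

section \<open>The counting theorem\<close>

lemma irrational_nonzero:
  assumes "\<alpha> \<notin> \<rat>" "q \<noteq> 0"
  shows "of_int p + of_int q * \<alpha> \<noteq> (0::real)"
proof
  assume "of_int p + of_int q * \<alpha> = 0"
  then have "\<alpha> = of_int (- p) / of_int q" using assms(2) by (simp add: field_simps)
  then show False using assms(1) by (metis Rats_divide Rats_of_int)
qed

text \<open>Carries the hypothesis on positive \<open>q\<close> over to all integer vectors: the
  integer compared with is \<open>- p\<close> for nonnegative \<open>q\<close> and \<open>p\<close>
  for negative \<open>q\<close>.\<close>

lemma dist_int_le: "dist_int (of_nat (nat \<bar>q\<bar>) * \<alpha>) \<le> \<bar>of_int p + of_int q * \<alpha>\<bar>"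
proof -
  let ?n = "of_nat (nat \<bar>q\<bar>) :: real"
  have "dist_int (?n * \<alpha>) \<le> \<bar>?n * \<alpha> - of_int m\<bar>" for m
    unfolding dist_int_eq_round using round_diff_minimal[of "?n * \<alpha>" m] by (simp add: abs_minus_commute)
  from this[of p] this[of "- p"] show ?thesis
    by (cases "q \<ge> 0") (auto simp: abs_minus_commute add.commute)
qed

text \<open>The sign change \<open>f (s, t)\<close> maps \<open>N s t\<close> bijectively onto the
  points of \<open>M_set\<close> whose first two coordinates have the signs \<open>s\<close> and
  \<open>t\<close>.\<close>

lemma card_M_set:
  fixes \<alpha> \<beta> \<epsilon> T Q :: real
  assumes "\<alpha> \<notin> \<rat>" "\<beta> \<notin> \<rat>"
  defines "N s t \<equiv> points_in (of_int s * \<alpha>) (of_int t * \<beta>) (hyp_slab \<epsilon> T Q 0 T)"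
  assumes fin: "\<And>s t. s \<in> {1, -1} \<Longrightarrow> t \<in> {1, -1} \<Longrightarrow> finite (N s t)"
  shows "card (M_set \<alpha> \<beta> \<epsilon> T Q) = card (N 1 1) + card (N 1 (-1)) + card (N (-1) 1) + card (N (-1) (-1))"
proof -
  define f :: "int \<times> int \<Rightarrow> int \<times> int \<times> int \<Rightarrow> int \<times> int \<times> int"
    where "f = (\<lambda>(s, t) (p1, p2, q). (s * p1, t * p2, q))"
  define I :: "(int \<times> int) set" where "I = {1, -1} \<times> {1, -1}"
  define G where "G st = f st ` N (fst st) (snd st)" for st
  have G: "G (s, t) = {(p1, p2, q) \<in> M_set \<alpha> \<beta> \<epsilon> T Q.
      0 < of_int s * (of_int p1 + of_int q * \<alpha>) \<and> 0 < of_int t * (of_int p2 + of_int q * \<beta>)}"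
    if st: "s \<in> {1, -1}" "t \<in> {1, -1}" for s t
  proof (intro equalityI subsetI)
    fix v assume "v \<in> G (s, t)"
    then obtain p1 p2 q where v: "v = (s * p1, t * p2, q)" and p: "(p1, p2, q) \<in> N s t"
      by (auto simp: G_def f_def)
    have "s * s = 1" "t * t = 1" using st by auto
    then show "v \<in> {(p1, p2, q) \<in> M_set \<alpha> \<beta> \<epsilon> T Q.
      0 < of_int s * (of_int p1 + of_int q * \<alpha>) \<and> 0 < of_int t * (of_int p2 + of_int q * \<beta>)}"
      using p st by (auto simp: v N_def points_in_def hyp_slab_def M_set_def abs_if algebra_simps)
  next
    fix v assume "v \<in> {(p1, p2, q) \<in> M_set \<alpha> \<beta> \<epsilon> T Q.
      0 < of_int s * (of_int p1 + of_int q * \<alpha>) \<and> 0 < of_int t * (of_int p2 + of_int q * \<beta>)}"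
    then obtain p1 p2 q where v: "v = (p1, p2, q)" and M: "(p1, p2, q) \<in> M_set \<alpha> \<beta> \<epsilon> T Q"
      and pos: "0 < of_int s * (of_int p1 + of_int q * \<alpha>)" "0 < of_int t * (of_int p2 + of_int q * \<beta>)"
      by auto
    have "(s * p1, t * p2, q) \<in> N s t"
      using M pos st by (auto simp: N_def points_in_def hyp_slab_def M_set_def abs_if algebra_simps)
    moreover have "v = f (s, t) (s * p1, t * p2, q)" using st by (auto simp: v f_def)
    ultimately show "v \<in> G (s, t)" by (auto simp: G_def)
  qed
  have "M_set \<alpha> \<beta> \<epsilon> T Q = (\<Union>st\<in>I. G st)"
  proof (intro equalityI subsetI)
    fix v assume v: "v \<in> M_set \<alpha> \<beta> \<epsilon> T Q"
    obtain p1 p2 q where v': "v = (p1, p2, q)" by (cases v)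
    define x y where "x = of_int p1 + of_int q * \<alpha>" and "y = of_int p2 + of_int q * \<beta>"
    have "q \<noteq> 0" using v by (auto simp: v' M_set_def)
    \<comment> \<open>Irrationality keeps all points off the coordinate planes, so the four sign
      patterns exhaust \<open>M_set\<close>.\<close>
    then have nz: "x \<noteq> 0" "y \<noteq> 0" unfolding x_def y_def using irrational_nonzero assms by blast+
    define s t :: int where "s = (if x > 0 then 1 else -1)" and "t = (if y > 0 then 1 else -1)"
    have "s \<in> {1, -1}" "t \<in> {1, -1}" "0 < of_int s * x" "0 < of_int t * y" using nz by (auto simp: s_def t_def)
    then have "v \<in> G (s, t)" "(s, t) \<in> I" using v by (auto simp: G v' x_def y_def I_def)
    then show "v \<in> (\<Union>st\<in>I. G st)" by blast
  qed (auto simp: I_def G)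
  then have "card (M_set \<alpha> \<beta> \<epsilon> T Q) = card (\<Union>st\<in>I. G st)" by simp
  also have "\<dots> = (\<Sum>st\<in>I. card (G st))"
  proof (rule card_UN_disjoint)
    show "\<forall>i\<in>I. finite (G i)" using fin by (auto simp: I_def G_def)
    show "\<forall>i\<in>I. \<forall>j\<in>I. i \<noteq> j \<longrightarrow> G i \<inter> G j = {}" by (auto simp: I_def G)
  qed (simp add: I_def)
  also have "\<dots> = (\<Sum>st\<in>I. card (N (fst st) (snd st)))"
  proof (rule sum.cong)
    fix st assume "st \<in> I"
    then have "inj (f st)" by (auto simp: I_def f_def inj_on_def)
    then show "card (G st) = card (N (fst st) (snd st))"
      unfolding G_def by (rule card_image[OF inj_on_subset[OF _ subset_UNIV]])
  qed simp
  also have "I = {(1, 1), (1, -1), (-1, 1), (-1, -1)}" by (auto simp: I_def)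
  finally show ?thesis by simp
qed

theorem theorem1p1:
  fixes \<alpha> \<beta> :: real and \<phi> :: "real \<Rightarrow> real" and Q \<epsilon> T :: real
  assumes "\<alpha> \<notin> \<rat>" and "\<beta> \<notin> \<rat>"
    and "\<phi> \<in> {1..} \<rightarrow> {0<..1/4}"
    and "antimono_on {1..} \<phi>"
    and "\<And>q::nat. 0 < q \<Longrightarrow>
      real q * dist_int (real q * \<alpha>) * dist_int (real q * \<beta>) \<ge> \<phi> (real q)"
    and "Q \<ge> 1" and "\<epsilon> > 0" and "T > 0" and "\<epsilon> / T^2 \<le> 1 / (exp 1)^2"
  shows "\<bar>real (card (M_set \<alpha> \<beta> \<epsilon> T Q)) - 4 * \<epsilon> * Q * (ln (T^2 / \<epsilon>) + 1)\<bar>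
    \<le> 3^28 * (1 + 2 * T)^2 * ln (T^2 / \<epsilon>) * (\<epsilon> * Q / \<phi> Q) powr (2/3)"
proof -
  define \<delta> L R where "\<delta> = \<phi> Q" and "L = ln (T\<^sup>2 / \<epsilon>)" and "R = \<epsilon> * Q / \<delta>"
  have \<delta>: "0 < \<delta>" "\<delta> \<le> 1 / 4" using assms(3) \<open>Q \<ge> 1\<close> by (auto simp: \<delta>_def Pi_iff)
  have pos: "0 < \<epsilon>" "0 < T" "0 < Q" using assms by auto
  have R: "0 < R" "\<epsilon> * Q = R * \<delta>" using pos \<delta> by (simp_all add: R_def)
  have L: "2 \<le> L"
  proof -
    have "exp 2 = (exp (1::real))\<^sup>2" by (simp add: exp_of_nat_mult[symmetric] flip: exp_double)
    then have "exp 2 \<le> T\<^sup>2 / \<epsilon>" using assms(9) pos by (simp add: field_simps)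
    then show ?thesis using pos by (simp add: L_def ln_ge_iff)
  qed
  \<comment> \<open>As \<open>\<phi>\<close> is non-increasing, its value at \<open>Q\<close> is a
    lower bound for all \<open>q\<close> up to \<open>Q\<close>.\<close>
  have adm: "\<delta> \<le> \<bar>of_int q\<bar> * \<bar>of_int p1 + of_int q * \<alpha>\<bar> * \<bar>of_int p2 + of_int q * \<beta>\<bar>"
    if q: "q \<noteq> 0" "\<bar>real_of_int q\<bar> \<le> Q" for p1 p2 q
  proof -
    let ?n = "nat \<bar>q\<bar>"
    have n: "0 < ?n" "real ?n = \<bar>real_of_int q\<bar>" "1 \<le> real ?n" "real ?n \<le> Q" using q by auto
    have "\<delta> \<le> \<phi> (real ?n)"
      unfolding \<delta>_def using \<open>antimono_on {1..} \<phi>\<close> n(3,4) \<open>Q \<ge> 1\<close>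
      by (intro monotone_onD[of "{1..}" "(\<le>)" "(\<ge>)" \<phi>]) auto
    also have "\<dots> \<le> real ?n * dist_int (real ?n * \<alpha>) * dist_int (real ?n * \<beta>)" using assms(5)[OF n(1)] .
    also have "\<dots> \<le> real ?n * \<bar>of_int p1 + of_int q * \<alpha>\<bar> * \<bar>of_int p2 + of_int q * \<beta>\<bar>"
      by (intro mult_mono dist_int_le) (auto simp: dist_int_eq_round)
    finally show ?thesis by (simp only: n(2))
  qed
  have "\<bar>real (card (M_set \<alpha> \<beta> \<epsilon> T Q)) - 4 * \<epsilon> * Q * (L + 1)\<bar> \<le> 103968 * (1 + T)\<^sup>2 * L * R powr (2/3)"
  \<comment> \<open>In the first case a point would satisfy
    \<open>\<delta> <= Q * \<epsilon>\<close>, so there are none and only the main term must be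
    bounded. It is \<open>4 * R * \<delta> * (L + 1)\<close>, where
    \<open>\<delta> <= 1 / 4\<close>, \<open>L + 1 <= 2 * L\<close> and
    \<open>R <= R powr (2/3)\<close> because \<open>R < 1\<close>.\<close>
  proof (cases "\<epsilon> * Q < \<delta>")
    case True
    have "M_set \<alpha> \<beta> \<epsilon> T Q = {}"
    proof (rule ccontr)
      assume "M_set \<alpha> \<beta> \<epsilon> T Q \<noteq> {}"
      then obtain p1 p2 q where p: "(p1, p2, q) \<in> M_set \<alpha> \<beta> \<epsilon> T Q" by (metis ex_in_conv surj_pair)
      have "\<delta> \<le> \<bar>of_int q\<bar> * \<bar>of_int p1 + of_int q * \<alpha>\<bar> * \<bar>of_int p2 + of_int q * \<beta>\<bar>"
        using p by (intro adm) (auto simp: M_set_def)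
      also have "\<dots> \<le> Q * \<epsilon>"
        unfolding mult.assoc using p pos by (intro mult_mono) (auto simp: M_set_def)
      finally show False using True by (simp add: mult.commute)
    qed
    moreover have "R < 1" using True \<delta> by (simp add: R_def)
    then have "R powr 1 \<le> R powr (2/3)" using R by (intro powr_mono') auto
    then have RR: "R \<le> R powr (2/3)" using R by simp
    have "4 * (\<epsilon> * Q) * (L + 1) \<le> R powr (2/3) * (2 * L)"
    proof (rule mult_mono)
      have "4 * (\<epsilon> * Q) \<le> R * 1" unfolding R(2) using mult_left_mono[of "4 * \<delta>" 1 R] \<delta> R(1) by simp
      then show "4 * (\<epsilon> * Q) \<le> R powr (2/3)" using RR by simp
    qed (use L in auto)
    moreover have "R powr (2/3) * (2 * L) = 2 * (L * R powr (2/3))" by simp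
    moreover have "2 * (L * R powr (2/3)) \<le> (103968 * (1 + T)\<^sup>2) * (L * R powr (2/3))"
    proof (rule mult_right_mono)
      have "1 \<le> (1 + T)\<^sup>2" using pos by simp
      then show "2 \<le> 103968 * (1 + T)\<^sup>2" by linarith
    qed (use L in simp)
    moreover have "0 \<le> 4 * (\<epsilon> * Q) * (L + 1)" using pos L by simp
    ultimately show ?thesis by (simp add: mult.assoc)
  next
    case False
    define \<rho> where "\<rho> = R powr (1/3)"
    have \<rho>: "0 < \<rho>" "\<rho> ^ 3 = \<epsilon> * Q / \<delta>" "\<rho>\<^sup>2 = R powr (2/3)"
      using R(1) by (simp_all add: \<rho>_def R_def[symmetric] powr_powr flip: powr_numeral)
    have quad: "finite (points_in (of_int s * \<alpha>) (of_int t * \<beta>) (hyp_slab \<epsilon> T Q 0 T))"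
      "\<bar>real (card (points_in (of_int s * \<alpha>) (of_int t * \<beta>) (hyp_slab \<epsilon> T Q 0 T))) - \<epsilon> * Q * (L + 1)\<bar>
        \<le> 25992 * L * (1 + T)\<^sup>2 * \<rho>\<^sup>2" if st: "s \<in> {1, -1}" "t \<in> {1, -1}" for s t :: int
    proof -
      \<comment> \<open>The lower bound survives sign changes of \<open>\<alpha>\<close> and
        \<open>\<beta>\<close>: the signs move to \<open>p1\<close> and \<open>p2\<close>.\<close>
      have "\<delta> \<le> \<bar>of_int q\<bar> * \<bar>of_int p1 + of_int q * (of_int s * \<alpha>)\<bar> * \<bar>of_int p2 + of_int q * (of_int t * \<beta>)\<bar>"
        if q: "q \<noteq> 0" "\<bar>real_of_int q\<bar> \<le> Q" for p1 p2 q
      proof -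
        have *: "\<bar>of_int (s * p) + of_int q * x\<bar> = \<bar>of_int p + of_int q * (of_int s * x)\<bar>"
          if "s \<in> {1, -1}" for s p :: int and x :: real using that by auto
        show ?thesis using adm[OF q, of "s * p1" "t * p2"] unfolding *[OF st(1)] *[OF st(2)] .
      qed
      note quadrant = points_in_quadrant[OF this pos \<delta>(1) _ \<rho>(1,2) L_def L]
      show "finite (points_in (of_int s * \<alpha>) (of_int t * \<beta>) (hyp_slab \<epsilon> T Q 0 T))"
        by (rule quadrant(1)) (use False in simp_all)
      show "\<bar>real (card (points_in (of_int s * \<alpha>) (of_int t * \<beta>) (hyp_slab \<epsilon> T Q 0 T))) - \<epsilon> * Q * (L + 1)\<bar>
        \<le> 25992 * L * (1 + T)\<^sup>2 * \<rho>\<^sup>2"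
        by (rule quadrant(2)) (use False in simp_all)
    qed
    define K m where "K = 25992 * L * (1 + T)\<^sup>2 * \<rho>\<^sup>2" and "m = \<epsilon> * Q * (L + 1)"
    have 1: "(1::int) \<in> {1, -1}" "(-1::int) \<in> {1, -1}" by simp_all
    note quad = quad[folded K_def m_def]
    let ?N = "\<lambda>s t :: int. card (points_in (of_int s * \<alpha>) (of_int t * \<beta>) (hyp_slab \<epsilon> T Q 0 T))"
    have card: "card (M_set \<alpha> \<beta> \<epsilon> T Q) = ?N 1 1 + ?N 1 (-1) + ?N (-1) 1 + ?N (-1) (-1)"
      by (rule card_M_set[OF assms(1,2)]) (rule quad(1))
    have "\<bar>real (card (M_set \<alpha> \<beta> \<epsilon> T Q)) - 4 * m\<bar> \<le> 4 * K"
      unfolding card of_nat_add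
      using quad(2)[OF 1(1) 1(1)] quad(2)[OF 1(1) 1(2)] quad(2)[OF 1(2) 1(1)] quad(2)[OF 1(2) 1(2)]
      unfolding abs_le_iff by linarith
    also have "4 * K = 103968 * (1 + T)\<^sup>2 * L * R powr (2/3)" unfolding K_def \<rho>(3) by simp
    finally show ?thesis unfolding m_def mult.assoc .
  qed
  \<comment> \<open>The constant \<open>103968 = 4 * 25992\<close>, one share per quadrant, is far
    below \<open>3^28\<close>.\<close>
  also have "\<dots> \<le> 3^28 * (1 + 2 * T)\<^sup>2 * L * R powr (2/3)"
    using pos L by (intro mult_right_mono mult_mono power_mono) auto
  finally show ?thesis by (simp only: L_def R_def \<delta>_def)
qed

end
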